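(* Let $p$ be a prime, $q=p^e$ a power of $p$ with $q\equiv 1 \pmod{12}$, and let $E$ be an elliptic curve over $\mathbb{F}_q$ with $j(E)\neq 0,1728$. Let $T$ be a generator of the character group $\widehat{\mathbb{F}_q^*}$. Then $$a(E(\mathbb{F}_q))=-q\cdot T^{\frac{q-1}{12}}\!\left(\frac{1728}{\Delta(E)}\right)\cdot {}_2F_1\!\left(\left.\begin{array}{cc} T^{\frac{q-1}{12}} & T^{\frac{q-1}{12}}\\ & T^{\frac{2(q-1)}{3}}\end{array}\right|\frac{j(E)}{1728}\right)_q,$$ where $\Delta(E)$ is the discriminant and $j(E)$ the $j$-invariant of $E$.
   Context: Every multiplicative character $\chi\in\widehat{\mathbb{F}_q^*}$ is extended to all of $\mathbb{F}_q$ by $\chi(0)=0$; $\varepsilon$ denotes the trivial character. For characters $A,B$ define the normalized Jacobi sum $\binom{A}{B}:=\frac{B(-1)}{q}\sum_{x\in\mathbb{F}_q}A(x)\overline{B}(1-x)$. For characters $A_0,A_1,B_1$ and $x\in\mathbb{F}_q$, Greene's Gaussian hypergeometric series is $${}_2F_1\!\left(\left.\begin{array}{cc} A_0 & A_1\\ & B_1\end{array}\right| x\right)_q:=\frac{q}{q-1}\sum_{\chi\in\widehat{\mathbb{F}_q^*}}\binom{A_0\chi}{\chi}\binom{A_1\chi}{B_1\chi}\chi(x).$$ The trace of Frobenius is $a(E(\mathbb{F}_q)):=q+1-|E(\mathbb{F}_q)|$, where $|E(\mathbb{F}_q)|$ is the number of projective $\mathbb{F}_q$-points of $E$. *)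

theory Defs
  imports
    Complex_Main
    "HOL-Library.Cardinality"
    "HOL-Number_Theory.Cong"
    "HOL-Algebra.Generated_Groups"
    "HOL-Algebra.Algebraic_Closure_Type"
begin

text \<open>A multiplicative character is a homomorphism from the nonzero elements to the nonzero
  complex numbers, extended to \<^term>\<open>0\<close> by the value \<^term>\<open>0\<close> (this includes the trivial character).\<close>

definition mult_char :: "('a::field \<Rightarrow> complex) \<Rightarrow> bool" where
  "mult_char \<chi> \<longleftrightarrow> \<chi> 0 = 0 \<and> (\<forall>x. x \<noteq> 0 \<longrightarrow> \<chi> x \<noteq> 0) \<and> (\<forall>x y. \<chi> (x * y) = \<chi> x * \<chi> y)"

definition char_group :: "('a::field \<Rightarrow> complex) monoid" where
  "char_group = \<lparr>carrier = {\<chi>. mult_char \<chi>},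
                 monoid.mult = (\<lambda>\<chi> \<psi> x. \<chi> x * \<psi> x),
                 one = (\<lambda>x. if x = 0 then 0 else 1)\<rparr>"

definition jacobi_binom ::
    "('a::finite_field \<Rightarrow> complex) \<Rightarrow> ('a \<Rightarrow> complex) \<Rightarrow> complex" where
  "jacobi_binom A B =
     B (-1) / of_nat CARD('a) * (\<Sum>x\<in>UNIV. A x * cnj (B (1 - x)))"

text \<open>Greene's finite-field hypergeometric function with upper parameters \<open>A0\<close>, \<open>A1\<close> and lower
  parameter \<open>B1\<close>.\<close>

definition greene_2F1 ::
    "('a::finite_field \<Rightarrow> complex) \<Rightarrow> ('a \<Rightarrow> complex) \<Rightarrow> ('a \<Rightarrow> complex) \<Rightarrow> 'a \<Rightarrow> complex" where
  "greene_2F1 A0 A1 B1 x =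
     of_nat CARD('a) / (of_nat CARD('a) - 1) *
     (\<Sum>\<chi>\<in>carrier char_group.
        jacobi_binom (A0 \<otimes>\<^bsub>char_group\<^esub> \<chi>) \<chi> *
        jacobi_binom (A1 \<otimes>\<^bsub>char_group\<^esub> \<chi>) (B1 \<otimes>\<^bsub>char_group\<^esub> \<chi>) * \<chi> x)"

text \<open>Coefficients of a general Weierstrass equation
  \<open>y\<^sup>2 + a1 x y + a3 y = x\<^sup>3 + a2 x\<^sup>2 + a4 x + a6\<close>.\<close>

datatype 'a weierstrass = Weierstrass (a1: 'a) (a2: 'a) (a3: 'a) (a4: 'a) (a6: 'a)

definition wpoly :: "'a::field weierstrass \<Rightarrow> 'a \<Rightarrow> 'a \<Rightarrow> 'a \<Rightarrow> 'a" where
  "wpoly E x y z = y^2 * z + a1 E * x * y * z + a3 E * y * z^2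
     - (x^3 + a2 E * x^2 * z + a4 E * x * z^2 + a6 E * z^3)"

text \<open>The formal partial derivatives of \<^const>\<open>wpoly\<close>.\<close>

definition wpoly_dx :: "'a::field weierstrass \<Rightarrow> 'a \<Rightarrow> 'a \<Rightarrow> 'a \<Rightarrow> 'a" where
  "wpoly_dx E x y z = a1 E * y * z - (3 * x^2 + 2 * a2 E * x * z + a4 E * z^2)"

definition wpoly_dy :: "'a::field weierstrass \<Rightarrow> 'a \<Rightarrow> 'a \<Rightarrow> 'a \<Rightarrow> 'a" where
  "wpoly_dy E x y z = 2 * y * z + a1 E * x * z + a3 E * z^2"

definition wpoly_dz :: "'a::field weierstrass \<Rightarrow> 'a \<Rightarrow> 'a \<Rightarrow> 'a \<Rightarrow> 'a" where
  "wpoly_dz E x y z = y^2 + a1 E * x * y + 2 * a3 E * y * z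
     - (a2 E * x^2 + 2 * a4 E * x * z + 3 * a6 E * z^2)"

text \<open>The projective Weierstrass cubic is smooth: it has no singular point over the algebraic
  closure. The base point \<open>(0:1:0)\<close> always lies on the curve.\<close>

definition elliptic_curve :: "'a::field weierstrass \<Rightarrow> bool" where
  "elliptic_curve E \<longleftrightarrow>
     (let E' = map_weierstrass to_ac E in
      \<nexists>x y z. (x, y, z) \<noteq> (0, 0, 0) \<and> wpoly E' x y z = 0 \<and>
         wpoly_dx E' x y z = 0 \<and> wpoly_dy E' x y z = 0 \<and> wpoly_dz E' x y z = 0)"

definition b2 :: "'a::field weierstrass \<Rightarrow> 'a" where
  "b2 E = a1 E ^ 2 + 4 * a2 E"

definition b4 :: "'a::field weierstrass \<Rightarrow> 'a" where
  "b4 E = 2 * a4 E + a1 E * a3 E"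

definition b6 :: "'a::field weierstrass \<Rightarrow> 'a" where
  "b6 E = a3 E ^ 2 + 4 * a6 E"

definition b8 :: "'a::field weierstrass \<Rightarrow> 'a" where
  "b8 E = a1 E ^ 2 * a6 E + 4 * a2 E * a6 E - a1 E * a3 E * a4 E + a2 E * a3 E ^ 2 - a4 E ^ 2"

definition c4 :: "'a::field weierstrass \<Rightarrow> 'a" where
  "c4 E = b2 E ^ 2 - 24 * b4 E"

definition discriminant :: "'a::field weierstrass \<Rightarrow> 'a" where
  "discriminant E = - (b2 E ^ 2 * b8 E) - 8 * b4 E ^ 3 - 27 * b6 E ^ 2 + 9 * b2 E * b4 E * b6 E"

definition j_invariant :: "'a::field weierstrass \<Rightarrow> 'a" where
  "j_invariant E = c4 E ^ 3 / discriminant E"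

text \<open>A point of the projective plane is the set of all its homogeneous coordinate triples.\<close>

definition proj_point :: "'a::field \<Rightarrow> 'a \<Rightarrow> 'a \<Rightarrow> ('a \<times> 'a \<times> 'a) set" where
  "proj_point x y z = {(c * x, c * y, c * z) | c. c \<noteq> 0}"

definition rational_points :: "'a::field weierstrass \<Rightarrow> ('a \<times> 'a \<times> 'a) set set" where
  "rational_points E =
     {proj_point x y z | x y z. (x, y, z) \<noteq> (0, 0, 0) \<and> wpoly E x y z = 0}"

definition frobenius_trace :: "'a::finite_field weierstrass \<Rightarrow> int" where
  "frobenius_trace E = int CARD('a) + 1 - int (card (rational_points E))"

end

theory Submission
  imports Defs
begin

text \<open>
  Let \<open>\<chi> = T\<^bsup>(q-1)/12\<^esup>\<close> and let \<open>\<phi> = \<chi>\<^sup>6\<close> be the quadratic character. Completing the square and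
  rescaling shows that \<open>a(E)\<close> is, up to a root of unity, \<open>S(t) = \<Sum>\<^sub>u \<phi>(u\<^sup>3 + t (u + 1))\<close> with
  \<open>t = -27 c\<^sub>4\<^sup>3 / (4 c\<^sub>6\<^sup>2)\<close>, while orthogonality of characters turns Greene's series into
  \<open>R(\<mu>) = \<Sum>\<^sub>v \<chi>\<^sup>5(v) \<chi>(1 - v) \<chi>\<^bsup>-1\<^esup>(1 - \<mu> v)\<close> with \<open>\<mu> = (j - 1728) / j = c\<^sub>6\<^sup>2 / c\<^sub>4\<^sup>3\<close>. Both
  have Mellin transforms that are, up to delta terms at two characters, products of two Jacobi
  sums, and these agree by the Hasse--Davenport product formulas for the exponents 2 and 3.

  The formula for exponent 3 says that, for a cubic character \<open>\<omega>\<close> and a character \<open>\<rho>\<close> with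
  \<open>\<rho>\<^sup>3 \<noteq> 1\<close>, the twisted Jacobi sum \<open>J(\<rho>) = \<Sum> \<rho>(a b c) \<omega>(b c\<^sup>2)\<close> over \<open>a + b + c = 3\<close> equals \<open>q\<close>.
  Its modulus is \<open>q\<close> anyway, and the sum of \<open>J(\<rho>)\<close> over all \<open>\<rho>\<close> only sees the points with
  \<open>a b c = 1\<close>. These form a nodal cubic on which \<open>\<omega>(b c\<^sup>2)\<close> is identically 1, so the total is as
  large as the triangle inequality permits and every term must equal its modulus.
\<close>

section \<open>Finite fields and their characters\<close>

lemma finite_field_card_gt_1: "CARD('a::finite_field) > 1"
proof -
  have "card {0, 1 :: 'a} \<le> CARD('a)" by (rule card_mono) auto
  thus ?thesis by simp
qed

text \<open>Adding 1 permutes the field, so the sum of all elements equals itself plus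
  \<open>CARD('a)\<close> ones.\<close>

lemma finite_field_of_nat_card: "of_nat CARD('a) = (0 :: 'a::finite_field)"
proof -
  have "(\<Sum>x\<in>UNIV. x + 1) = (\<Sum>x\<in>UNIV. x :: 'a)"
    by (rule sum.reindex_bij_witness[of _ "\<lambda>x. x - 1" "\<lambda>x. x + 1"]) auto
  thus ?thesis by (simp add: sum.distrib)
qed

lemma finite_field_power_card_minus_1:
  "x ^ (CARD('a) - 1) = 1" if "x \<noteq> 0" for x :: "'a::finite_field"
proof -
  define k where "k = CARD('a) - 1"
  have "Suc k = CARD('a)" using finite_field_card_gt_1[where ?'a = 'a] by (simp add: k_def)
  hence "x ^ k * x = 1 * x" using finite_field_power_card_eq_same[of x] by (metis mult_1 power_Suc2)
  hence "x ^ k = 1" using that by simp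
  thus ?thesis by (simp only: k_def)
qed

text \<open>Cyclicity of the unit group is a fact about record-style rings;
  \<open>ring_of_type_algebra\<close> carries it over to the type class.\<close>

lemma finite_field_generator:
  obtains g :: "'a::finite_field" where "g \<noteq> 0" "\<And>x. x \<noteq> 0 \<Longrightarrow> \<exists>j::nat. x = g ^ j"
proof -
  let ?R = "ring_of_type_algebra :: 'a ring"
  interpret R: field ?R by (rule field_from_type_algebra)
  have R: "carrier ?R = UNIV" "\<one>\<^bsub>?R\<^esub> = 1" "\<zero>\<^bsub>?R\<^esub> = 0" "\<And>x y. x \<otimes>\<^bsub>?R\<^esub> y = x * y"
    by (simp_all add: ring_of_type_algebra_def)
  let ?G = "Multiplicative_Group.mult_of ?R"
  have pow: "x [^]\<^bsub>?R\<^esub> (j::nat) = x ^ j" for x j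
    by (induction j) (simp_all add: R mult.commute)
  have "finite (carrier ?R)" by (simp add: R(1))
  from R.finite_field_mult_group_has_gen[OF this]
  obtain g where g: "g \<in> carrier ?G" "carrier ?G = {g [^]\<^bsub>?R\<^esub> i | i::nat. i \<in> UNIV}"
    by (rule bexE)
  show ?thesis
  proof
    show "g \<noteq> 0" using g(1) by (simp add: R)
    fix x :: 'a assume "x \<noteq> 0"
    hence "x \<in> carrier ?G" by (simp add: R)
    thus "\<exists>j::nat. x = g ^ j" unfolding g(2) pow by blast
  qed
qed

text \<open>The character is \<open>x \<mapsto> exp (2 \<pi> i Tr x / p)\<close>; the trace is not identically zero since it
  is a polynomial function of degree less than \<open>q\<close>.\<close>

lemma finite_field_additive_character:
  assumes p: "Factorial_Ring.prime p" and card: "CARD('a::finite_field) = p ^ e"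
  obtains \<psi> :: "'a::finite_field \<Rightarrow> complex" where "\<psi> 0 = 1" "\<And>x y. \<psi> (x + y) = \<psi> x * \<psi> y"
    "\<And>x. cnj (\<psi> x) = \<psi> (- x)" "\<exists>x. \<psi> x \<noteq> 1"
proof -
  have "of_nat p = (0 :: 'a)"
    using finite_field_of_nat_card[where ?'a = 'a] by (simp add: card)
  hence "CHAR('a) dvd p" by (simp add: of_nat_eq_0_iff_char_dvd)
  hence char: "CHAR('a) = p" using p CHAR_prime by (metis primes_dvd_imp_eq)
  have p1: "p > 1" using p by (rule prime_gt_1_nat)
  have e: "e > 0"
    using finite_field_card_gt_1[where ?'a = 'a] card by (cases e) auto
  define Tr where "Tr x = (\<Sum>i<e. x ^ (p ^ i))" for x :: 'a
  have Tr_add: "Tr (x + y) = Tr x + Tr y" for x y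
  proof -
    have "(x + y) ^ (p ^ i) = x ^ (p ^ i) + y ^ (p ^ i)" for i
      by (rule freshmans_dream') (use CHAR_prime char in auto)
    thus ?thesis by (simp add: Tr_def sum.distrib)
  qed
  \<comment> \<open>Frobenius shifts the summands by one, and the last one wraps around to the first
    because \<open>x ^ (p ^ e) = x\<close>.\<close>
  have Tr_frob: "Tr x ^ p = Tr x" for x
  proof -
    have "Tr x ^ p = (\<Sum>i<e. (x ^ (p ^ i)) ^ p)"
      unfolding Tr_def by (rule freshmans_dream_sum) (use CHAR_prime char in auto)
    also have "\<dots> = (\<Sum>i<e. x ^ (p ^ Suc i))"
      by (simp add: power_mult [symmetric] mult.commute)
    also have "\<dots> = (\<Sum>i<Suc e. x ^ (p ^ i)) - x"
      by (subst sum.lessThan_Suc_shift) simp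
    also have "\<dots> = Tr x"
      using finite_field_power_card_eq_same[of x] by (simp add: Tr_def card)
    finally show ?thesis .
  qed
  \<comment> \<open>The first p numerals are distinct roots of X^p - X, which has at most p roots,
    so they are all of them.\<close>
  have prime_field: "\<exists>k<p. y = of_nat k" if "y ^ p = y" for y :: 'a
  proof -
    define P :: "'a poly" where "P = monom 1 p - monom 1 1"
    have "coeff P p = 1" using p1 by (simp add: P_def)
    hence P0: "P \<noteq> 0" by auto
    have "degree P \<le> p"
      using p1 unfolding P_def by (intro degree_diff_le) (auto simp: degree_monom_eq)
    hence card_roots: "card {z. poly P z = 0} \<le> p" using card_poly_roots_bound[OF P0] by linarith
    have roots: "poly P z = 0 \<longleftrightarrow> z ^ p = z" for z by (simp add: P_def poly_monom)
    have inj: "inj_on (of_nat :: nat \<Rightarrow> 'a) {..<p}"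
      by (rule inj_onI) (auto simp: of_nat_eq_iff_cong_CHAR char cong_def)
    have frob: "(of_nat k :: 'a) ^ p = of_nat k" for k
    proof (induction k)
      case (Suc k)
      have "(1 + of_nat k :: 'a) ^ p = 1 ^ p + of_nat k ^ p"
        by (rule freshmans_dream) (use CHAR_prime char in auto)
      thus ?case using Suc by simp
    qed (use p1 in simp)
    have "of_nat ` {..<p} = {z. poly P z = 0}"
    proof (rule card_seteq)
      show "finite {z. poly P z = 0}" using P0 by (rule poly_roots_finite)
      show "of_nat ` {..<p} \<subseteq> {z. poly P z = 0}" by (auto simp: roots frob)
      show "card {z. poly P z = 0} \<le> card ((of_nat :: nat \<Rightarrow> 'a) ` {..<p})"
        using card_roots inj by (simp add: card_image)
    qed
    moreover have "y \<in> {z. poly P z = 0}" using that by (simp add: roots)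
    ultimately show ?thesis by blast
  qed
  have "\<exists>x. Tr x \<noteq> 0"
  proof (rule ccontr)
    assume "\<not> (\<exists>x. Tr x \<noteq> 0)"
    hence zero: "Tr x = 0" for x by blast
    define P :: "'a poly" where "P = (\<Sum>i<e. monom 1 (p ^ i))"
    have poly_P: "poly P x = Tr x" for x by (simp add: P_def Tr_def poly_sum poly_monom)
    have "coeff P (p ^ (e - 1)) = (\<Sum>i<e. if i = e - 1 then 1 else 0)"
      unfolding P_def coeff_sum using p1 by (intro sum.cong) auto
    also have "\<dots> = 1" using e by simp
    finally have P0: "P \<noteq> 0" by auto
    have "degree P \<le> p ^ (e - 1)"
      unfolding P_def
    proof (rule degree_sum_le)
      fix i assume "i \<in> {..<e}"
      hence "p ^ i \<le> p ^ (e - 1)" using p1 by (intro power_increasing) auto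
      thus "degree (monom (1 :: 'a) (p ^ i)) \<le> p ^ (e - 1)" by (simp add: degree_monom_eq)
    qed simp
    moreover have "CARD('a) \<le> degree P"
      using card_poly_roots_bound[OF P0] by (simp add: poly_P zero)
    moreover have "p ^ (e - 1) < p ^ e" using p1 e by (intro power_strict_increasing) auto
    ultimately show False using card by simp
  qed
  then obtain x0 where x0: "Tr x0 \<noteq> 0" by blast
  \<comment> \<open>An arbitrary natural number representing the trace; by \<open>cis_cong\<close>
    only its residue modulo p matters.\<close>
  define ind where "ind x = (SOME k. Tr x = of_nat k)" for x
  have ind: "Tr x = of_nat (ind x)" for x
    unfolding ind_def using prime_field[OF Tr_frob[of x]] by (metis (mono_tags, lifting) someI_ex)
  define \<psi> where "\<psi> x = cis (2 * pi * real (ind x) / real p)" for x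
  have cis_cong: "cis (2 * pi * real k / real p) = cis (2 * pi * real l / real p)"
    if "(of_nat k :: 'a) = of_nat l" for k l
  proof -
    have mod: "cis (2 * pi * real k / real p) = cis (2 * pi * real (k mod p) / real p)" for k
    proof -
      have "real k = real (k mod p) + real p * real (k div p)"
        by (metis mod_mult_div_eq of_nat_add of_nat_mult)
      hence "2 * pi * real k / real p = 2 * pi * real (k mod p) / real p + 2 * pi * real (k div p)"
        using p1 by (simp add: field_simps)
      moreover have "cis (2 * pi * real (k div p)) = 1" by (rule cis_multiple_2pi) simp
      ultimately show ?thesis by (simp add: cis_mult [symmetric])
    qed
    have "k mod p = l mod p" using that by (simp add: of_nat_eq_iff_cong_CHAR char cong_def)
    thus ?thesis using mod[of k] mod[of l] by simp
  qed
  have \<psi>_eq: "\<psi> x = cis (2 * pi * real k / real p)" if "Tr x = of_nat k" for x k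
    unfolding \<psi>_def using ind[of x] that by (intro cis_cong) simp
  have Tr_0: "Tr 0 = 0" using p1 by (simp add: Tr_def power_0_left)
  have zero: "\<psi> 0 = 1" using \<psi>_eq[of 0 0] Tr_0 by simp
  have add: "\<psi> (x + y) = \<psi> x * \<psi> y" for x y
  proof -
    have "Tr (x + y) = of_nat (ind x + ind y)" by (simp add: Tr_add ind [symmetric])
    from \<psi>_eq[OF this] show ?thesis by (simp add: \<psi>_def cis_mult add_divide_distrib distrib_left)
  qed
  have cnj: "cnj (\<psi> x) = \<psi> (- x)" for x
  proof -
    have "\<psi> x * \<psi> (- x) = 1" using add[of x "- x"] zero by simp
    moreover have "\<psi> x * cnj (\<psi> x) = 1" by (simp add: \<psi>_def complex_norm_square [symmetric])
    ultimately show ?thesis by (metis mult_cancel_left mult_zero_left zero_neq_one)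
  qed
  have "\<psi> x0 \<noteq> 1"
  proof
    assume 1: "\<psi> x0 = 1"
    obtain k where k: "k < p" "Tr x0 = of_nat k" using prime_field[OF Tr_frob] by blast
    have "k \<noteq> 0" using k x0 by (metis of_nat_0)
    have "cis (2 * pi * real k / real p) = cis (2 * pi * real 0 / real p)"
      using 1 \<psi>_eq[OF k(2)] by simp
    hence "k = 0"
      using bij_betw_roots_unity[of p] k(1) p1 unfolding bij_betw_def inj_on_def by auto
    thus False using \<open>k \<noteq> 0\<close> by simp
  qed
  thus ?thesis using that zero add cnj by blast
qed

section \<open>The character group and a field generator adapted to \<open>T\<close>\<close>

lemma char_group_group: "group (char_group :: ('a::field \<Rightarrow> complex) monoid)"
proof (rule groupI)
  fix \<chi> :: "'a \<Rightarrow> complex" assume "\<chi> \<in> carrier char_group"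
  hence \<chi>: "mult_char \<chi>" by (simp add: char_group_def)
  have "mult_char (\<lambda>x. inverse (\<chi> x))" using \<chi> by (auto simp: mult_char_def)
  moreover have "(\<lambda>x. inverse (\<chi> x)) \<otimes>\<^bsub>char_group\<^esub> \<chi> = \<one>\<^bsub>char_group\<^esub>"
    using \<chi> by (auto simp: char_group_def mult_char_def)
  ultimately show "\<exists>\<chi>'\<in>carrier char_group. \<chi>' \<otimes>\<^bsub>char_group\<^esub> \<chi> = \<one>\<^bsub>char_group\<^esub>"
    by (auto simp: char_group_def)
qed (auto simp: char_group_def mult_char_def mult_ac fun_eq_iff)

text \<open>The case split matters for exponent 0: the trivial character vanishes at 0, whereas
  \<open>\<chi> 0 ^ 0 = 1\<close>.\<close>

lemma char_group_nat_pow: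
  "(\<chi> [^]\<^bsub>char_group\<^esub> (k::nat)) x = (if x = 0 then 0 else \<chi> x ^ k)" if "\<chi> 0 = 0"
  by (induction k) (auto simp: char_group_def nat_pow_def that)

text \<open>The characters with value 1 at x form a subgroup. This serves to show that a generating
  character has trivial kernel.\<close>

lemma generate_char_group_trivial:
  fixes T :: "'a::field \<Rightarrow> complex"
  assumes T: "T \<in> carrier char_group" and x: "x \<noteq> 0" "T x = 1"
    and \<chi>: "\<chi> \<in> generate char_group {T}"
  shows "\<chi> x = 1"
proof -
  interpret group "char_group :: ('a \<Rightarrow> complex) monoid" by (rule char_group_group)
  from \<chi> show ?thesis
  proof (induction rule: generate.induct)
    case one
    thus ?case using x by (simp add: char_group_def)
  next
    case (incl \<chi>)
    thus ?case using x by simp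
  next
    case (inv \<chi>)
    have "(T \<otimes>\<^bsub>char_group\<^esub> inv\<^bsub>char_group\<^esub> T) x = \<one>\<^bsub>char_group\<^esub> x"
      using T by (simp add: r_inv)
    thus ?case using inv x by (simp add: char_group_def)
  next
    case (eng \<chi> \<chi>')
    thus ?case by (simp add: char_group_def)
  qed
qed

text \<open>Some character is injective on the units and lies in the group generated by
  \<open>T\<close>, so \<open>T\<close> is injective too. By counting, \<open>T\<close> then reaches
  all n-th roots of unity, and g is the preimage of the standard primitive one.\<close>

lemma generating_character_generator:
  fixes T :: "'a::finite_field \<Rightarrow> complex"
  assumes T: "T \<in> carrier char_group" and gen: "generate char_group {T} = carrier char_group"
  obtains g :: 'a where "g \<noteq> 0" "\<And>x. x \<noteq> 0 \<Longrightarrow> \<exists>j::nat. x = g ^ j"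
    "T g = cis (2 * pi / real (CARD('a) - 1))"
proof -
  define n where "n = CARD('a) - 1"
  have n: "CARD('a) = n + 1" "n > 0"
    using finite_field_card_gt_1[where ?'a = 'a] by (simp_all add: n_def)
  have Tm: "T 0 = 0" "\<And>x. x \<noteq> 0 \<Longrightarrow> T x \<noteq> 0" "\<And>x y. T (x * y) = T x * T y"
    using T by (auto simp: char_group_def mult_char_def)
  have T1: "T 1 = 1" using Tm(3)[of 1 1] Tm(2)[of 1] by simp
  have T_pow: "T (x ^ j) = T x ^ j" for x j by (induction j) (simp_all add: T1 Tm(3))
  have pow_n: "x ^ n = 1" if "x \<noteq> 0" for x :: 'a
    using finite_field_power_card_minus_1[OF that] by (simp add: n_def)
  obtain g0 :: 'a where g0: "g0 \<noteq> 0" "\<And>x. x \<noteq> 0 \<Longrightarrow> \<exists>j::nat. x = g0 ^ j"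
    by (rule finite_field_generator) blast
  have reduce: "g0 ^ j = g0 ^ (j mod n)" for j
  proof -
    have "g0 ^ j = g0 ^ (n * (j div n) + j mod n)" by simp
    thus ?thesis using pow_n[OF g0(1)] by (simp only: power_add power_mult power_one mult_1)
  qed
  have image: "(\<lambda>j. g0 ^ j) ` {..<n} = UNIV - {0}"
  proof (intro equalityI subsetI)
    fix x :: 'a assume "x \<in> UNIV - {0}"
    then obtain j where "x = g0 ^ j" using g0(2) by blast
    hence "x = g0 ^ (j mod n)" using reduce by simp
    thus "x \<in> (\<lambda>j. g0 ^ j) ` {..<n}" using n by auto
  qed (use g0 in auto)
  have "inj_on (\<lambda>j. g0 ^ j) {..<n}"
    by (rule eq_card_imp_inj_on) (simp_all add: image n card_Diff_singleton)
  hence bij: "bij_betw (\<lambda>j. g0 ^ j) {..<n} (UNIV - {0})" using image by (simp add: bij_betw_def)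
  define ind where "ind = inv_into {..<n} (\<lambda>j. g0 ^ j)"
  have ind: "ind x < n" "g0 ^ ind x = x" if "x \<noteq> 0" for x
    using that image
        by (auto simp: ind_def f_inv_into_f intro: inv_into_into[of _ _ "{..<n}", simplified])
  have ind_pow: "ind (g0 ^ j) = j mod n" for j
    unfolding reduce[of j] ind_def using bij n by (intro inv_into_f_f) (auto simp: bij_betw_def)
  define z where "z = cis (2 * pi / real n)"
  have zn: "z ^ n = 1" using n by (simp add: z_def DeMoivre)
  have z_pow: "z ^ j = cis (2 * pi * real j / real n)" for j by (simp add: z_def DeMoivre mult_ac)
  have z_mod: "z ^ (j mod n) = z ^ j" for j
  proof -
    have "z ^ j = z ^ (n * (j div n) + j mod n)" by simp
    thus ?thesis using zn by (simp only: power_add power_mult power_one mult_1)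
  qed
  \<comment> \<open>A character with trivial kernel, built from the discrete logarithm to base
    \<open>g0\<close>.\<close>
  define \<chi> where "\<chi> x = (if x = 0 then 0 else z ^ ind x)" for x
  have "mult_char \<chi>"
    unfolding mult_char_def
  proof (intro conjI allI impI)
    fix x y :: 'a
    show "\<chi> (x * y) = \<chi> x * \<chi> y"
    proof (cases "x = 0 \<or> y = 0")
      case False
      hence "x * y = g0 ^ (ind x + ind y)" using ind by (simp add: power_add)
      hence "ind (x * y) = (ind x + ind y) mod n" by (simp add: ind_pow)
      thus ?thesis using False by (simp add: \<chi>_def z_mod power_add)
    qed (auto simp: \<chi>_def)
  qed (auto simp: \<chi>_def z_def)
  have T_inj: "x = 1" if "x \<noteq> 0" "T x = 1" for x
  proof -
    have "\<chi> \<in> generate char_group {T}"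
      using \<open>mult_char \<chi>\<close> by (simp add: gen) (simp add: char_group_def)
    hence "\<chi> x = 1" using generate_char_group_trivial[OF T that] by blast
    hence "cis (2 * pi * real (ind x) / real n) = cis (2 * pi * real 0 / real n)"
      using that by (simp add: \<chi>_def z_pow)
    hence "ind x = 0"
      using bij_betw_roots_unity[OF n(2)] ind(1)[OF that(1)] n(2)
      unfolding bij_betw_def inj_on_def by auto
    thus ?thesis using ind(2)[OF that(1)] by simp
  qed
  have T_eq: "x = y" if "x \<noteq> 0" "y \<noteq> 0" "T x = T y" for x y
  proof -
    have "T (x / y) * T y = T x" using that by (simp flip: Tm(3))
    hence "T (x / y) = 1" using that Tm(2)[of y] by simp
    hence "x / y = 1" using that by (intro T_inj) auto
    thus ?thesis using that by simp
  qed
  have "inj_on T (UNIV - {0})" by (rule inj_onI) (use T_eq in auto)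
  hence "card (T ` (UNIV - {0})) = n" by (simp add: card_image n card_Diff_singleton)
  moreover have "T ` (UNIV - {0}) \<subseteq> {w. w ^ n = 1}" by (auto simp: T_pow [symmetric] pow_n T1)
  ultimately have T_image: "T ` (UNIV - {0}) = {w. w ^ n = 1}"
    using n(2) by (intro card_subset_eq finite_roots_unity) (simp_all add: card_roots_unity_eq)
  have "z \<in> T ` (UNIV - {0})" unfolding T_image using zn by simp
  then obtain g where g: "g \<noteq> 0" "T g = z" by auto
  have "\<exists>j::nat. x = g ^ j" if "x \<noteq> 0" for x
  proof -
    have "T x ^ n = 1" using that by (simp add: T_pow [symmetric] pow_n T1)
    hence "T x \<in> (\<lambda>j. cis (2 * pi * real j / real n)) ` {..<n}"
      using bij_betw_roots_unity[OF n(2)] by (simp add: bij_betw_def)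
    then obtain j where "T x = z ^ j" unfolding z_pow by blast
    hence "T x = T (g ^ j)" by (simp add: T_pow g)
    thus ?thesis using T_eq that g(1) by (metis power_not_zero)
  qed
  moreover have "T g = cis (2 * pi / real (CARD('a) - 1))" by (simp add: g z_def n_def)
  ultimately show ?thesis using that g(1) by blast
qed

section \<open>Gauss and Jacobi sums\<close>

text \<open>The value at \<gamma> pins down \<open>T\<close> as an isomorphism from the units onto
  the roots of unity of order q - 1, so integer exponents index all characters. The additive
  character \<psi> serves to form Gauss sums.\<close>

locale finite_field_characters =
  fixes T :: "'a::finite_field \<Rightarrow> complex" and \<gamma> :: 'a and \<psi> :: "'a \<Rightarrow> complex"
  assumes T_mult: "T (x * y) = T x * T y"
    and generator_nonzero: "\<gamma> \<noteq> 0"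
    and generator: "x \<noteq> 0 \<Longrightarrow> \<exists>j::nat. x = \<gamma> ^ j"
    and T_generator: "T \<gamma> = cis (2 * pi / real (CARD('a) - 1))"
    and \<psi>_0 [simp]: "\<psi> 0 = 1"
    and \<psi>_add: "\<psi> (x + y) = \<psi> x * \<psi> y"
    and \<psi>_cnj: "cnj (\<psi> x) = \<psi> (- x)"
    and \<psi>_nontrivial: "\<exists>x. \<psi> x \<noteq> 1"
begin

definition n :: nat where "n = CARD('a) - 1"

text \<open>Integer exponents give inverse characters the same notation. The branch at 0 makes the
  trivial character vanish there, where a zeroth power would be 1.\<close>

definition chi :: "int \<Rightarrow> 'a \<Rightarrow> complex" where
  "chi k x = (if x = 0 then 0 else T x powi k)"

definition gauss :: "int \<Rightarrow> complex" where
  "gauss k = (\<Sum>x\<in>UNIV. chi k x * \<psi> x)"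

definition jacobi :: "int \<Rightarrow> int \<Rightarrow> complex" where
  "jacobi k l = (\<Sum>x\<in>UNIV. chi k x * chi l (1 - x))"

lemma n_pos: "n > 0"
  using finite_field_card_gt_1[where ?'a = 'a] by (simp add: n_def)

lemma card_eq: "CARD('a) = n + 1"
  using finite_field_card_gt_1[where ?'a = 'a] by (simp add: n_def)

lemma power_n: "x ^ n = 1" if "x \<noteq> 0" for x :: 'a
  using finite_field_power_card_minus_1[OF that] by (simp add: n_def)

lemma T_1: "T 1 = 1"
proof -
  have "T \<gamma> = T 1 * T \<gamma>" using T_mult[of 1 \<gamma>] by simp
  thus ?thesis by (simp add: T_generator)
qed

lemma T_power: "T (x ^ j) = T x ^ j"
  by (induction j) (simp_all add: T_1 T_mult)

lemma T_power_n: "T x ^ n = 1" if "x \<noteq> 0"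
  using power_n[OF that] T_power[of x n] T_1 by simp

lemma T_nonzero: "T x \<noteq> 0" if "x \<noteq> 0"
  using T_power_n[OF that] n_pos by (auto simp: power_0_left)

lemma norm_T: "norm (T x) = 1" if "x \<noteq> 0"
proof -
  have "norm (T x) ^ n = 1" using T_power_n[OF that] by (metis norm_power norm_one)
  thus ?thesis using n_pos power_eq_1_iff[of "norm (T x)" n] by simp
qed

lemma chi_0 [simp]: "chi k 0 = 0"
  and chi_1 [simp]: "chi k 1 = 1"
  by (simp_all add: chi_def T_1)

lemma chi_nonzero [simp]: "chi k x = 0 \<longleftrightarrow> x = 0"
  by (simp add: chi_def T_nonzero)

lemma chi_mult: "chi k (x * y) = chi k x * chi k y"
  by (simp add: chi_def T_mult power_int_mult_distrib)

lemma chi_power: "chi k (x ^ j) = chi k x ^ j"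
  by (induction j) (simp_all add: chi_mult)

lemma chi_inverse: "chi k (inverse x) = inverse (chi k x)"
proof (cases "x = 0")
  case False
  have "chi k (inverse x) * chi k x = chi k (inverse x * x)" by (rule chi_mult [symmetric])
  also have "\<dots> = 1" using False by simp
  finally show ?thesis using False by (simp add: field_simps)
qed simp

lemma chi_divide: "chi k (x / y) = chi k x / chi k y"
  by (simp add: divide_inverse chi_mult chi_inverse)

lemma chi_add: "chi (k + l) x = chi k x * chi l x"
  by (simp add: chi_def T_nonzero power_int_add)

lemma chi_uminus: "chi (- k) x = inverse (chi k x)"
  by (simp add: chi_def power_int_minus)

lemma chi_diff: "chi (k - l) x = chi k x / chi l x"
  using chi_add[of k "- l" x] by (simp add: chi_uminus divide_inverse)

lemma chi_times_nat: "chi (k * int j) x = chi k x ^ j" if "x \<noteq> 0"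
  using that by (simp add: chi_def power_int_mult)

lemma norm_chi: "x \<noteq> 0 \<Longrightarrow> norm (chi k x) = 1"
  by (simp add: chi_def norm_power_int norm_T)

lemma cnj_chi: "cnj (chi k x) = chi (- k) x"
proof (cases "x = 0")
  case False
  have "chi k x * cnj (chi k x) = 1"
    using norm_chi[OF False, of k] by (simp add: complex_norm_square [symmetric])
  thus ?thesis using False by (simp add: chi_uminus field_simps)
qed simp

lemma chi_trivial: "chi k x = (if x = 0 then 0 else 1)" if "int n dvd k"
proof -
  from that obtain j where j: "k = int n * j" by (rule dvdE)
  show ?thesis
    by (auto simp: chi_def j power_int_mult T_power_n)
qed

lemma chi_cong: "chi k x = chi l x" if "int n dvd k - l"
proof (cases "x = 0")
  case False
  have "chi k x = chi (k - l) x * chi l x"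
    by (simp flip: chi_add)
  thus ?thesis using that False by (simp add: chi_trivial)
qed simp

lemma chi_generator: "chi k \<gamma> = cis (2 * pi * of_int k / real n)"
proof -
  have "chi k \<gamma> = cis (2 * pi / real n) powi k"
    using T_generator generator_nonzero by (simp add: chi_def n_def)
  thus ?thesis by (simp add: cis_power_int mult_ac)
qed

lemma chi_generator_neq_1: "chi k \<gamma> \<noteq> 1" if "\<not> int n dvd k"
proof
  assume c: "chi k \<gamma> = 1"
  define r where "r = nat (k mod int n)"
  have r: "int r = k mod int n" using n_pos by (simp add: r_def)
  hence rn: "r < n" using n_pos pos_mod_bound[of "int n" k] by linarith
  have "int n dvd k - int r" by (simp add: r minus_mod_eq_div_mult)
  hence "chi (int r) \<gamma> = 1" using chi_cong c by metis
  hence "cis (2 * pi * real r / real n) = cis (2 * pi * real 0 / real n)"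
    by (simp add: chi_generator)
  moreover have "inj_on (\<lambda>k. cis (2 * pi * real k / real n)) {..<n}"
    using bij_betw_roots_unity[OF n_pos] by (auto simp: bij_betw_def)
  ultimately have "r = 0" using rn n_pos unfolding inj_on_def by blast
  thus False using r that by (simp add: mod_eq_0_iff_dvd)
qed

lemma T_eq_1_iff: "T x = 1 \<longleftrightarrow> x = 1" if "x \<noteq> 0"
proof
  assume x: "T x = 1"
  from generator[OF that] obtain j where j: "x = \<gamma> ^ j" by blast
  have "chi (int j) \<gamma> = 1"
    using x generator_nonzero by (simp add: chi_def j T_power)
  hence "int n dvd int j" using chi_generator_neq_1 by blast
  hence "n dvd j" by simp
  then obtain i where "j = n * i" by (rule dvdE)
  thus "x = 1" using generator_nonzero by (simp add: j power_mult power_n)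
qed (simp add: T_1)

section \<open>Orthogonality of multiplicative characters and Mellin inversion\<close>

lemma sum_times_left: "(\<Sum>x\<in>UNIV. f (a * x)) = (\<Sum>x\<in>UNIV. f x)" if "a \<noteq> 0"
  for f :: "'a \<Rightarrow> complex"
  by (rule sum.reindex_bij_witness[of _ "\<lambda>x. x / a" "\<lambda>x. a * x"]) (use that in auto)

lemma sum_one: "(\<Sum>x\<in>UNIV - {0::'a}. 1) = (of_nat n :: complex)"
  by (simp add: n_def card_Diff_singleton)

lemma sum_remove_0: "(\<Sum>x\<in>UNIV. f x) = f 0 + (\<Sum>x\<in>UNIV - {0}. f x)"
  for f :: "'a \<Rightarrow> complex"
  by (rule sum.remove) auto

lemma sum_chi: "(\<Sum>x\<in>UNIV. chi k x) = (if int n dvd k then of_nat n else 0)"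
proof (cases "int n dvd k")
  case True
  have "(\<Sum>x\<in>UNIV - {0}. chi k x) = (\<Sum>x\<in>UNIV - {0::'a}. 1)"
    by (intro sum.cong) (simp_all add: chi_trivial[OF True])
  thus ?thesis using True unfolding sum_remove_0 sum_one by simp
next
  case False
  have "(\<Sum>x\<in>UNIV. chi k x) = (\<Sum>x\<in>UNIV. chi k (\<gamma> * x))"
    by (rule sum_times_left [OF generator_nonzero, symmetric])
  also have "\<dots> = chi k \<gamma> * (\<Sum>x\<in>UNIV. chi k x)"
    by (simp add: chi_mult sum_distrib_left)
  finally show ?thesis using chi_generator_neq_1[OF False] False by simp
qed

lemma sum_chi_index: "(\<Sum>k<n. chi (int k) x) = (if x = 1 then of_nat n else 0)"
proof (cases "x = 0 \<or> x = 1")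
  case False
  have "(\<Sum>k<n. chi (int k) x) = (\<Sum>k<n. T x ^ k)"
    using False by (simp add: chi_def)
  also have "\<dots> = (T x ^ n - 1) / (T x - 1)"
    using False by (intro geometric_sum) (simp add: T_eq_1_iff)
  also have "\<dots> = 0" using False by (simp add: T_power_n)
  finally show ?thesis using False by simp
qed auto

lemma sum_chi_index_eq:
  "(\<Sum>k<n. chi (int k) x * chi (- int k) y) = (if x = y \<and> y \<noteq> 0 then of_nat n else 0)"
proof -
  have "(\<Sum>k<n. chi (int k) x * chi (- int k) y) = (\<Sum>k<n. chi (int k) (x / y))"
    by (intro sum.cong) (simp_all add: chi_mult chi_inverse chi_uminus divide_inverse)
  thus ?thesis by (auto simp: sum_chi_index)
qed

text \<open>Fourier inversion on the multiplicative group: summing the transforms against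
  \<open>chi (- k) y\<close> recovers the value at y. The value at 0 is invisible because characters
  vanish there.\<close>

lemma mellin_inject:
  fixes f h :: "'a \<Rightarrow> complex"
  assumes eq: "\<And>k. (\<Sum>x\<in>UNIV. chi k x * f x) = (\<Sum>x\<in>UNIV. chi k x * h x)" and y: "y \<noteq> 0"
  shows "f y = h y"
proof -
  have inv: "(\<Sum>k<n. chi (- int k) y * (\<Sum>x\<in>UNIV. chi (int k) x * f x)) = of_nat n * f y" for f
  proof -
    have "(\<Sum>k<n. chi (- int k) y * (\<Sum>x\<in>UNIV. chi (int k) x * f x)) =
          (\<Sum>x\<in>UNIV. f x * (\<Sum>k<n. chi (int k) x * chi (- int k) y))"
      by (simp add: sum_distrib_left mult_ac) (rule sum.swap)
    also have "\<dots> = of_nat n * f y"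
      using y by (simp add: sum_chi_index_eq if_distrib[of "\<lambda>z. _ * z"] mult_ac cong: if_cong)
    finally show ?thesis .
  qed
  have "of_nat n * f y = of_nat n * h y"
    unfolding inv [symmetric] eq ..
  thus ?thesis using n_pos by simp
qed

lemma sum_add_left: "(\<Sum>x\<in>UNIV. f (a + x)) = (\<Sum>x\<in>UNIV. f x)"
  for f :: "'a \<Rightarrow> complex"
  by (rule sum.reindex_bij_witness[of _ "\<lambda>x. x - a" "\<lambda>x. a + x"]) auto

lemma sum_\<psi>: "(\<Sum>x\<in>UNIV. \<psi> (a * x)) = (if a = 0 then of_nat CARD('a) else 0)"
proof (cases "a = 0")
  case False
  obtain b where b: "\<psi> b \<noteq> 1" using \<psi>_nontrivial by blast
  have "(\<Sum>x\<in>UNIV. \<psi> x) = (\<Sum>x\<in>UNIV. \<psi> (b + x))" by (rule sum_add_left [symmetric])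
  also have "\<dots> = \<psi> b * (\<Sum>x\<in>UNIV. \<psi> x)" by (simp add: \<psi>_add sum_distrib_left)
  finally show ?thesis using b False by (simp add: sum_times_left)
qed simp

section \<open>Gauss sums and their relation to Jacobi sums\<close>

lemma gauss_cong: "gauss k = gauss l" if "int n dvd k - l"
  using chi_cong[OF that] by (simp add: gauss_def)

lemma gauss_trivial: "gauss k = -1" if "int n dvd k"
proof -
  have "gauss k = (\<Sum>x\<in>UNIV - {0}. \<psi> (1 * x))"
    unfolding gauss_def sum_remove_0 by (simp add: chi_trivial[OF that])
  also have "\<dots> = (\<Sum>x\<in>UNIV. \<psi> (1 * x)) - 1" by (simp add: sum_remove_0)
  finally show ?thesis by (simp add: sum_\<psi> del: mult_1)
qed

lemma gauss_twist: "(\<Sum>x\<in>UNIV. chi k x * \<psi> (a * x)) = chi (- k) a * gauss k" if "a \<noteq> 0"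
proof -
  have "gauss k = (\<Sum>x\<in>UNIV. chi k (a * x) * \<psi> (a * x))"
    unfolding gauss_def by (rule sum_times_left [OF that, symmetric])
  also have "\<dots> = chi k a * (\<Sum>x\<in>UNIV. chi k x * \<psi> (a * x))"
    by (simp add: chi_mult sum_distrib_left mult_ac)
  finally show ?thesis using that by (simp add: chi_uminus)
qed

lemma chi_minus_one_square: "chi k (-1) * chi k (-1) = 1"
  by (simp flip: chi_mult)

lemma chi_uminus_minus_one: "chi (- k) (-1) = chi k (-1)"
  using chi_minus_one_square[of k] by (simp add: chi_uminus field_simps)

lemma gauss_minus: "(\<Sum>x\<in>UNIV. chi k x * \<psi> (- x)) = chi k (-1) * gauss k"
  using gauss_twist[of "-1" k] by (simp add: chi_uminus_minus_one)

lemma cnj_gauss: "cnj (gauss k) = chi k (-1) * gauss (- k)"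
  using gauss_minus[of "- k"] by (simp add: gauss_def cnj_chi \<psi>_cnj chi_uminus_minus_one)

lemma gauss_mult_minus:
  "gauss k * gauss (- k) = chi k (-1) * (if int n dvd k then 1 else of_nat CARD('a))"
proof (cases "int n dvd k")
  case True
  thus ?thesis by (simp add: gauss_trivial chi_trivial)
next
  case False
  have "chi k (-1) * gauss (- k) * gauss k = (\<Sum>y\<in>UNIV. chi (- k) y * \<psi> (- y)) * gauss k"
    by (simp only: gauss_minus chi_uminus_minus_one)
  also have "\<dots> = (\<Sum>y\<in>UNIV. chi (- k) y * \<psi> (- y) * gauss k)"
    by (rule sum_distrib_right)
  \<comment> \<open>The inner sum is a twisted Gauss sum. At \<open>y = 0\<close> both sides vanish,
    the right one because a nontrivial character sums to 0.\<close>
  also have "\<dots> = (\<Sum>y\<in>UNIV. \<Sum>x\<in>UNIV. \<psi> (- y) * (chi k x * \<psi> (y * x)))"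
  proof (intro sum.cong refl)
    fix y
    show "chi (- k) y * \<psi> (- y) * gauss k = (\<Sum>x\<in>UNIV. \<psi> (- y) * (chi k x * \<psi> (y * x)))"
      using gauss_twist[of y k] False
      by (cases "y = 0") (simp_all add: sum_chi sum_distrib_left [symmetric] mult_ac)
  qed
  also have "\<dots> = (\<Sum>x\<in>UNIV. \<Sum>y\<in>UNIV. \<psi> (- y) * (chi k x * \<psi> (y * x)))"
    by (rule sum.swap)
  also have "\<dots> = (\<Sum>x\<in>UNIV. chi k x * (\<Sum>y\<in>UNIV. \<psi> ((x - 1) * y)))"
    by (simp add: sum_distrib_left mult.left_commute[of "\<psi> _"] \<psi>_add [symmetric] algebra_simps)
  also have "\<dots> = of_nat CARD('a)"
    by (simp add: sum_\<psi> if_distrib[of "\<lambda>z. _ * z"] cong: if_cong)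
  finally have "chi k (-1) * (chi k (-1) * gauss (- k) * gauss k) = chi k (-1) * of_nat CARD('a)"
    by simp
  moreover have "chi k (-1) * (chi k (-1) * gauss (- k) * gauss k) =
      (chi k (-1) * chi k (-1)) * (gauss k * gauss (- k))"
    by (simp add: mult_ac)
  ultimately show ?thesis using False by (simp add: chi_minus_one_square)
qed

lemma gauss_nonzero: "gauss k \<noteq> 0"
  using gauss_mult_minus[of k] by (auto split: if_splits)

lemma norm_gauss: "norm (gauss k) ^ 2 = (if int n dvd k then 1 else real CARD('a))"
proof -
  have "complex_of_real (norm (gauss k) ^ 2) = gauss k * cnj (gauss k)"
    using complex_norm_square[of "gauss k"] by simp
  also have "\<dots> = chi k (-1) * (gauss k * gauss (- k))"
    by (simp add: cnj_gauss)
  also have "\<dots> = (chi k (-1) * chi k (-1)) * (if int n dvd k then 1 else of_nat CARD('a))"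
    by (simp only: gauss_mult_minus mult.assoc)
  also have "\<dots> = complex_of_real (if int n dvd k then 1 else real CARD('a))"
    by (simp add: chi_minus_one_square)
  finally show ?thesis by (simp only: of_real_eq_iff)
qed

text \<open>A product of two Gauss sums, grouped by the sum s of the two arguments, is a
  convolution; every nonzero s contributes a multiple of the Jacobi sum. Multiplying by
  \<open>gauss (- (k + l))\<close>, rather than dividing by \<open>gauss (k + l)\<close>, gives one
  formula that also covers trivial \<open>k + l\<close>.\<close>

lemma jacobi_gauss:
  assumes "\<not> (int n dvd k \<and> int n dvd l)"
  shows "of_nat CARD('a) * jacobi k l = chi (k + l) (-1) * gauss k * gauss l * gauss (- (k + l))"
proof -
  define c where "c s = (\<Sum>x\<in>UNIV. chi k x * chi l (s - x))" for s
  have c: "c s = chi (k + l) s * jacobi k l" if "s \<noteq> 0" for s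
  proof -
    have "c s = (\<Sum>x\<in>UNIV. chi k (s * x) * chi l (s - s * x))"
      unfolding c_def by (rule sum_times_left [OF that, symmetric])
    also have "\<dots> = (\<Sum>x\<in>UNIV. chi k (s * x) * chi l (s * (1 - x)))"
      by (simp add: algebra_simps)
    finally show ?thesis
      by (simp add: jacobi_def chi_mult chi_add sum_distrib_left mult_ac)
  qed
  have "c 0 = (\<Sum>x\<in>UNIV. chi l (-1) * chi (k + l) x)"
    unfolding c_def
  proof (intro sum.cong refl)
    fix x show "chi k x * chi l (0 - x) = chi l (-1) * chi (k + l) x"
      using chi_mult[of l "-1" x] by (simp add: chi_add)
  qed
  hence c0: "c 0 = chi l (-1) * (if int n dvd k + l then of_nat n else 0)"
    by (simp add: sum_chi flip: sum_distrib_left)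
  have "gauss k * gauss l = (\<Sum>x\<in>UNIV. \<Sum>y\<in>UNIV. (chi k x * \<psi> x) * (chi l y * \<psi> y))"
    unfolding gauss_def by (rule sum_product)
  also have "\<dots> = (\<Sum>x\<in>UNIV. \<Sum>s\<in>UNIV. (chi k x * \<psi> x) * (chi l (- x + s) * \<psi> (- x + s)))"
    by (rule sum.cong [OF refl]) (rule sum_add_left [symmetric])
  also have "\<dots> = (\<Sum>x\<in>UNIV. \<Sum>s\<in>UNIV. \<psi> s * (chi k x * chi l (s - x)))"
  proof (intro sum.cong refl)
    fix x s
    have "\<psi> x * \<psi> (- x + s) = \<psi> s" by (simp flip: \<psi>_add)
    thus "(chi k x * \<psi> x) * (chi l (- x + s) * \<psi> (- x + s)) = \<psi> s * (chi k x * chi l (s - x))"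
      by (simp add: mult_ac)
  qed
  also have "\<dots> = (\<Sum>s\<in>UNIV. \<psi> s * c s)"
    unfolding c_def by (subst sum.swap) (simp add: sum_distrib_left)
  also have "\<dots> = c 0 + (\<Sum>s\<in>UNIV - {0}. \<psi> s * c s)"
    by (simp add: sum_remove_0)
  also have "(\<Sum>s\<in>UNIV - {0}. \<psi> s * c s) = (\<Sum>s\<in>UNIV - {0}. chi (k + l) s * \<psi> s * jacobi k l)"
    by (intro sum.cong) (simp_all add: c)
  also have "\<dots> = gauss (k + l) * jacobi k l"
    by (simp add: gauss_def sum_remove_0 sum_distrib_right)
  finally have prod: "gauss k * gauss l = c 0 + gauss (k + l) * jacobi k l" .
  show ?thesis
  proof (cases "int n dvd k + l")
    case False
    have "chi (k + l) (-1) * gauss k * gauss l * gauss (- (k + l)) =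
          chi (k + l) (-1) * (gauss (k + l) * gauss (- (k + l))) * jacobi k l"
      using prod False by (simp add: c0 mult_ac)
    also have "\<dots> = (chi (k + l) (-1) * chi (k + l) (-1)) * of_nat CARD('a) * jacobi k l"
      unfolding gauss_mult_minus using False by simp
    finally show ?thesis by (simp add: chi_minus_one_square)
  next
    case True
    have l: "\<not> int n dvd l" using assms True by (metis dvd_add_left_iff)
    have "gauss k = gauss (- l)" using True by (intro gauss_cong) simp
    hence kl: "gauss k * gauss l = chi l (-1) * of_nat CARD('a)"
      using gauss_mult_minus[of l] l by (simp add: mult_ac)
    hence "jacobi k l = - chi l (-1)"
      using prod True by (simp add: c0 gauss_trivial card_eq algebra_simps eq_neg_iff_add_eq_0)
    moreover have "gauss (- (k + l)) = -1"
      using True by (intro gauss_trivial) (simp only: dvd_minus_iff)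
    moreover have "chi (k + l) (-1) = 1" using True by (simp add: chi_trivial)
    ultimately show ?thesis using kl by simp
  qed
qed

section \<open>Counting squares and the duplication formula\<close>

lemma of_nat_n: "of_nat n = (-1 :: 'a)"
  using finite_field_of_nat_card[where ?'a = 'a]
  by (simp add: card_eq eq_neg_iff_add_eq_0 add.commute)

text \<open>A divisor of n that vanished in the field would make n vanish there, but n is
  -1.\<close>

lemma two_nonzero: "(2 :: 'a) \<noteq> 0" if "even n"
proof
  assume "(2 :: 'a) = 0"
  from that obtain h where "n = 2 * h" by (rule evenE)
  thus False using of_nat_n \<open>(2 :: 'a) = 0\<close> by simp
qed

lemma three_nonzero: "(3 :: 'a) \<noteq> 0" if "3 dvd n"
proof
  assume "(3 :: 'a) = 0"
  from that obtain h where "n = 3 * h" by (rule dvdE)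
  thus False using of_nat_n \<open>(3 :: 'a) = 0\<close> by simp
qed

lemma chi_quadratic_generator: "chi (int h) \<gamma> = -1" if "n = 2 * h"
proof -
  have "2 * pi * real h / real n = pi" using that n_pos by simp
  thus ?thesis by (simp add: chi_generator)
qed

text \<open>The parity of the discrete logarithm decides between two roots and none. At
  \<open>w = 0\<close> the convention \<open>chi (int h) 0 = 0\<close> leaves the single root
  0.\<close>

lemma card_square_roots:
  assumes h: "n = 2 * h"
  shows "of_nat (card {y. y ^ 2 = w}) = 1 + chi (int h) w"
proof (cases "w = 0")
  case False
  from generator[OF False] obtain j where j: "w = \<gamma> ^ j" by blast
  have chi_w: "chi (int h) w = (-1) ^ j"
    by (simp add: j chi_power chi_quadratic_generator[OF h])
  show ?thesis
  proof (cases "even j")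
    case True
    then obtain i where i: "j = 2 * i" by (rule evenE)
    have "{y. y ^ 2 = w} = {\<gamma> ^ i, - (\<gamma> ^ i)}"
      by (auto simp: j i power_mult mult.commute[of 2] power2_eq_iff)
    moreover have "\<gamma> ^ i \<noteq> - (\<gamma> ^ i)"
    proof
      assume "\<gamma> ^ i = - (\<gamma> ^ i)"
      hence "2 * \<gamma> ^ i = 0" by (simp add: eq_neg_iff_add_eq_0)
      thus False using two_nonzero h generator_nonzero by simp
    qed
    ultimately show ?thesis using True by (simp add: chi_w)
  next
    case odd: False
    have "y ^ 2 \<noteq> w" for y
    proof
      assume y: "y ^ 2 = w"
      hence "y \<noteq> 0" using False by auto
      hence "chi (int h) w = chi (int n) y"
        using h chi_times_nat[of y "int h" 2] by (simp add: chi_power y [symmetric] mult.commute)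
      thus False using \<open>y \<noteq> 0\<close> odd by (simp add: chi_w chi_trivial)
    qed
    thus ?thesis using odd by (simp add: chi_w)
  qed
qed simp

lemma sum_squares:
  assumes "n = 2 * h"
  shows "(\<Sum>y\<in>UNIV. f (y ^ 2)) = (\<Sum>w\<in>UNIV. (1 + chi (int h) w) * f w)"
proof -
  have "(\<Sum>y\<in>UNIV. f (y ^ 2)) = (\<Sum>w\<in>UNIV. \<Sum>y\<in>{y\<in>UNIV. y ^ 2 = w}. f (y ^ 2))"
    by (rule sum.group [symmetric]) auto
  also have "\<dots> = (\<Sum>w\<in>UNIV. of_nat (card {y. y ^ 2 = w}) * f w)"
    by (intro sum.cong refl) simp
  finally show ?thesis by (simp add: card_square_roots[OF assms])
qed

text \<open>The substitution x = (1 + y) / 2 turns x (1 - x) into (1 - y^2) / 4, and the squares are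
  then counted by the quadratic character. This is the core of the duplication formula.\<close>

lemma jacobi_diagonal:
  assumes h: "n = 2 * h" and k: "\<not> int n dvd k"
  shows "jacobi k k = chi (- k) 4 * jacobi k (int h)"
proof -
  have two: "(2 :: 'a) \<noteq> 0" using two_nonzero h by simp
  hence four: "(4 :: 'a) \<noteq> 0" by (metis mult_eq_0_iff mult_2 numeral_Bit0)
  have "jacobi k k = (\<Sum>x\<in>UNIV. chi k (x * (1 - x)))"
    by (simp add: jacobi_def chi_mult)
  also have "\<dots> = (\<Sum>y\<in>UNIV. chi k ((1 / 2 + 1 / 2 * y) * (1 - (1 / 2 + 1 / 2 * y))))"
    using sum_times_left[of "1 / 2" "\<lambda>x. chi k ((1 / 2 + x) * (1 - (1 / 2 + x)))"] two
      sum_add_left[of "\<lambda>x. chi k (x * (1 - x))" "1 / 2"] by simp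
  also have "\<dots> = (\<Sum>y\<in>UNIV. chi (- k) 4 * chi k (1 - y ^ 2))"
  proof (intro sum.cong refl)
    fix y :: 'a
    have "(1 / 2 + 1 / 2 * y) * (1 - (1 / 2 + 1 / 2 * y)) = (1 - y ^ 2) / 4"
      using two four by (simp add: field_simps power2_eq_square)
    thus "chi k ((1 / 2 + 1 / 2 * y) * (1 - (1 / 2 + 1 / 2 * y))) = chi (- k) 4 * chi k (1 - y ^ 2)"
      by (simp only: chi_divide chi_uminus) (simp add: field_simps)
  qed
  also have "\<dots> = chi (- k) 4 * ((\<Sum>w\<in>UNIV. chi k (1 - w)) + (\<Sum>w\<in>UNIV. chi (int h) w *
      chi k (1 - w)))"
    unfolding sum_distrib_left [symmetric] sum_squares[OF h, of "\<lambda>w. chi k (1 - w)"]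
    by (simp add: distrib_right sum.distrib)
  also have "(\<Sum>w\<in>UNIV. chi k (1 - w)) = (\<Sum>w\<in>UNIV. chi k w)"
    by (rule sum.reindex_bij_witness[of _ "\<lambda>x. 1 - x" "\<lambda>x. 1 - x"]) auto
  also have "\<dots> = 0" using k by (simp add: sum_chi)
  also have "(\<Sum>w\<in>UNIV. chi (int h) w * chi k (1 - w)) = (\<Sum>w\<in>UNIV. chi k w * chi (int h) (1 - w))"
    by (rule sum.reindex_bij_witness[of _ "\<lambda>x. 1 - x" "\<lambda>x. 1 - x"]) auto
  finally show ?thesis by (simp add: jacobi_def)
qed

text \<open>For nontrivial l, both Jacobi sums in \<open>jacobi_diagonal\<close> at exponent
  \<open>- l\<close> are expanded into Gauss sums. One copy of \<open>gauss (- l)\<close> cancels;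
  the other is traded for \<open>gauss l\<close> by \<open>gauss_mult_minus\<close>.\<close>

theorem hasse_davenport_2:
  assumes h: "n = 2 * h"
  shows "gauss l * gauss (l + int h) * gauss (int h) =
    chi (int h) (-1) * of_nat CARD('a) * chi (- l) 4 * gauss (2 * l)"
proof -
  have "(2 :: 'a) \<noteq> 0" using two_nonzero h by simp
  hence four: "(4 :: 'a) \<noteq> 0" by (metis mult_eq_0_iff mult_2 numeral_Bit0)
  have hh: "\<not> int n dvd int h" using h n_pos by (auto dest: dvd_imp_le)
  show ?thesis
  proof (cases "int n dvd l")
    case True
    have "gauss (l + int h) = gauss (- int h)"
      using True h by (intro gauss_cong) (simp add: algebra_simps)
    moreover have "gauss (2 * l) = -1" using True by (intro gauss_trivial) auto
    ultimately show ?thesis using True four hh gauss_mult_minus[of "int h"]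
      by (simp add: gauss_trivial chi_trivial mult.commute)
  next
    case l: False
    hence nl: "\<not> int n dvd - l" by simp
    have "gauss (- l) * gauss (- l) * gauss (2 * l) = of_nat CARD('a) * jacobi (- l) (- l)"
    proof -
      have "chi (- l + - l) (-1) = 1" by (simp only: chi_add chi_minus_one_square)
      moreover have "- (- l + - l) = 2 * l" by simp
      ultimately show ?thesis using jacobi_gauss[of "- l" "- l"] nl by simp
    qed
    also have "\<dots> = chi l 4 * (of_nat CARD('a) * jacobi (- l) (int h))"
      by (simp add: jacobi_diagonal[OF h nl])
    also have "\<dots> = chi l 4 * (chi (- l + int h) (-1) * gauss (- l) * gauss (int h) *
        gauss (l - int h))"
      using jacobi_gauss[of "- l" "int h"] nl by simp
    also have "gauss (l - int h) = gauss (l + int h)"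
      using h by (intro gauss_cong) simp
    finally have *: "gauss (- l) * gauss (2 * l) =
        chi l 4 * chi l (-1) * chi (int h) (-1) * gauss (int h) * gauss (l + int h)"
      using gauss_nonzero[of "- l"]
      by (simp add: chi_add chi_uminus_minus_one del: uminus_add_conv_diff)
    have "gauss l * (gauss (- l) * gauss (2 * l)) = chi l (-1) * of_nat CARD('a) * gauss (2 * l)"
      using gauss_mult_minus[of l] l by (simp add: mult.assoc [symmetric])
    hence "chi l (-1) * (of_nat CARD('a) * gauss (2 * l)) =
        chi l (-1) * (chi l 4 * chi (int h) (-1) * (gauss l * gauss (l + int h) * gauss (int h)))"
      unfolding * by (simp add: mult_ac)
    hence "of_nat CARD('a) * gauss (2 * l) =
        chi l 4 * chi (int h) (-1) * (gauss l * gauss (l + int h) * gauss (int h))"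
      by simp
    hence "chi (int h) (-1) * of_nat CARD('a) * chi (- l) 4 * gauss (2 * l) =
        (chi (int h) (-1) * chi (int h) (-1)) * (chi (- l) 4 * chi l 4) *
        (gauss l * gauss (l + int h) * gauss (int h))"
      by (simp add: mult_ac)
    thus ?thesis using four by (simp add: chi_minus_one_square chi_uminus)
  qed
qed

end

section \<open>The Hasse--Davenport formula for cubic characters\<close>

text \<open>With a = 3 - b - c, the curve a b c = 1 is parametrised by lines through its singular
  point (1, 1, 1): t is the slope (a - 1) / (c - 1). The roots of t^2 + t + 1 are the tangent
  directions there, and lead back to the singular point.\<close>

lemma nodal_cubic_param:
  fixes t :: "'a::field"
  assumes "t \<noteq> 0" "t \<noteq> -1"
  defines "b \<equiv> (1 + t) ^ 2 / t" and "c \<equiv> - 1 / (t * (1 + t))"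
  shows "(3 - b - c) * b * c = 1" "b * c ^ 2 = inverse (t ^ 3)" "c = 1 \<longleftrightarrow> t ^ 2 + t + 1 = 0"
    "2 - b - c = t * (c - 1)"
proof -
  have t: "1 + t \<noteq> 0" using assms by (metis add_eq_0_iff minus_minus)
  have "3 - b - c = - (t ^ 2) / (1 + t)"
    using t assms(1) unfolding b_def c_def
    by (simp add: divide_simps) (simp add: power2_eq_square algebra_simps)
  thus "(3 - b - c) * b * c = 1"
    using t assms(1) unfolding b_def c_def by (simp add: power2_eq_square)
  show "b * c ^ 2 = inverse (t ^ 3)"
    using t assms(1) unfolding b_def c_def
    by (simp add: power2_eq_square power3_eq_cube inverse_eq_divide)
  have "c = 1 \<longleftrightarrow> - 1 = t * (1 + t)" using t assms(1) by (simp add: c_def divide_simps)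
  also have "\<dots> \<longleftrightarrow> t ^ 2 + t + 1 = 0"
    by (simp add: eq_neg_iff_add_eq_0 power2_eq_square algebra_simps eq_commute[of "- 1"])
  finally show "c = 1 \<longleftrightarrow> t ^ 2 + t + 1 = 0" .
  show "2 - b - c = t * (c - 1)"
    using t assms(1) unfolding b_def c_def
    by (simp add: divide_simps) (simp add: power2_eq_square algebra_simps)
qed

lemma nodal_cubic_param_inverse:
  fixes b c :: "'a::field"
  assumes eq: "(3 - b - c) * b * c = 1" and ne: "\<not> (b = 1 \<and> c = 1)"
  defines "t \<equiv> (2 - b - c) / (c - 1)"
  shows "t \<noteq> 0" "t \<noteq> -1" "b = (1 + t) ^ 2 / t" "c = - 1 / (t * (1 + t))"
proof -
  \<comment> \<open>Let a = 3 - b - c. If one of a, b, c is 1, the other two have sum 2 and product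
    1, hence are both 1. So away from the singular point none of the three is 1.\<close>
  have c1: "c \<noteq> 1"
  proof
    assume "c = 1"
    moreover have "(b - 1) ^ 2 = 1 - (3 - b - 1) * b * 1"
      by (simp add: power2_eq_square algebra_simps)
    ultimately show False using ne eq by simp
  qed
  have b1: "b \<noteq> 1"
  proof
    assume "b = 1"
    moreover have "(c - 1) ^ 2 = 1 - (3 - 1 - c) * 1 * c"
      by (simp add: power2_eq_square algebra_simps)
    ultimately show False using ne eq by simp
  qed
  have bc: "2 - b - c \<noteq> 0"
  proof
    assume "2 - b - c = 0"
    hence b: "b = 2 - c" by (simp add: algebra_simps)
    have "(c - 1) ^ 2 = 1 - (3 - (2 - c) - c) * (2 - c) * c"
      by (simp add: power2_eq_square algebra_simps)
    thus False using c1 eq unfolding b by simp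
  qed
  have nz: "c - 1 \<noteq> 0" "1 - b \<noteq> 0" using c1 b1 by auto
  have t1: "1 + t = (1 - b) / (c - 1)" using nz by (simp add: t_def divide_simps)
  show "t \<noteq> 0" using bc nz by (simp add: t_def)
  have "1 + t \<noteq> 0" using t1 nz by simp
  thus "t \<noteq> -1" by auto
  \<comment> \<open>Modulo the curve equation this is (1 + t)^2 = b t with denominators cleared; c
    is treated likewise below.\<close>
  have "(1 - b) ^ 2 = b * (c - 1) * (2 - b - c) + 1 - (3 - b - c) * b * c"
    by (simp add: power2_eq_square algebra_simps)
  hence "(1 - b) ^ 2 = b * (c - 1) * (2 - b - c)" using eq by simp
  thus "b = (1 + t) ^ 2 / t"
    unfolding t1 using bc nz by (simp add: t_def divide_simps power2_eq_square)
  have "(c - 1) ^ 2 = - c * (2 - b - c) * (1 - b) + 1 - (3 - b - c) * b * c"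
    by (simp add: power2_eq_square algebra_simps)
  hence "(c - 1) ^ 2 = - c * (2 - b - c) * (1 - b)" using eq by simp
  thus "c = - 1 / (t * (1 + t))"
    unfolding t1 using bc nz by (simp add: t_def divide_simps power2_eq_square)
qed

section \<open>The twisted Jacobi sum in three variables and the triplication formula\<close>

context finite_field_characters
begin

text \<open>The Jacobi sum of the characters with exponents k, k + h, k + 2 h over the plane a + b +
  c = 3, with a eliminated. The level 3 puts (1, 1, 1), the singular point of the cubic section a b
  c = 1, on the plane.\<close>

definition jacobi3 :: "nat \<Rightarrow> int \<Rightarrow> complex" where
  "jacobi3 h k = (\<Sum>b\<in>UNIV. \<Sum>c\<in>UNIV.
     chi k ((3 - b - c) * b * c) * chi (int h) (b * c ^ 2))"

text \<open>The condition a + b + c = 3 is detected by summing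
  \<open>\<psi> (d * (a + b + c - 3))\<close> over d, which splits the triple sum into three twisted
  Gauss sums. Since \<open>n = 3 * h\<close>, the three characters multiply to
  \<open>chi (3 * k)\<close>, and the sum over d is the fourth Gauss sum.\<close>

lemma jacobi3_gauss:
  assumes h: "n = 3 * h"
  shows "of_nat CARD('a) * jacobi3 h k =
    chi k 27 * gauss k * gauss (k + int h) * gauss (k + 2 * int h) * cnj (gauss (3 * k))"
proof -
  define A where "A l d = (\<Sum>a\<in>UNIV. chi l a * \<psi> (d * a))" for l d
  have A: "A l d = chi (- l) d * gauss l" if "d \<noteq> 0" for l d
    unfolding A_def using that by (rule gauss_twist)
  let ?l = "k + int h" and ?m = "k + 2 * int h"
  have three: "(3 :: 'a) \<noteq> 0" using three_nonzero h by simp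
  \<comment> \<open>The term \<open>d = 0\<close> vanishes: the exponents k and k + h differ by h,
    so they are not both trivial.\<close>
  have A0: "A k 0 * A ?l 0 * A ?m 0 = 0"
  proof -
    have "\<not> (int n dvd k \<and> int n dvd ?l)"
    proof
      assume *: "int n dvd k \<and> int n dvd ?l"
      hence "int n dvd ?l - k" by (intro dvd_diff) auto
      thus False using h n_pos by (auto dest: dvd_imp_le)
    qed
    thus ?thesis by (auto simp: A_def sum_chi)
  qed
  have "(\<Sum>d\<in>UNIV. \<psi> (- 3 * d) * (A k d * A ?l d * A ?m d)) =
        (\<Sum>d\<in>UNIV. chi (- (3 * k)) d * \<psi> (- 3 * d) * (gauss k * gauss ?l * gauss ?m))"
  proof (intro sum.cong refl)
    fix d :: 'a
    show "\<psi> (- 3 * d) * (A k d * A ?l d * A ?m d) =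
        chi (- (3 * k)) d * \<psi> (- 3 * d) * (gauss k * gauss ?l * gauss ?m)"
    proof (cases "d = 0")
      case False
      have "chi (- k) d * chi (- ?l) d * chi (- ?m) d = chi (- k + - ?l + - ?m) d"
        by (simp only: chi_add)
      also have "\<dots> = chi (- (3 * k)) d"
        using h by (intro chi_cong) simp
      finally have "chi (- k) d * chi (- ?l) d * chi (- ?m) d = chi (- (3 * k)) d" .
      thus ?thesis using False by (simp add: A mult_ac)
    qed (simp add: A0)
  qed
  also have "\<dots> = chi (3 * k) (- 3) * gauss (- (3 * k)) * (gauss k * gauss ?l * gauss ?m)"
    using gauss_twist[of "- 3" "- (3 * k)"] three by (simp flip: sum_distrib_right)
  \<comment> \<open>The level 3 of the plane gives 27 = 3^3; the sign is absorbed by the complex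
    conjugation.\<close>
  also have "chi (3 * k) (- 3) * gauss (- (3 * k)) = chi k 27 * cnj (gauss (3 * k))"
  proof -
    have "chi (3 * k) (- 3) = chi (3 * k) (-1) * chi (3 * k) 3"
      using chi_mult[of "3 * k" "-1" 3] by simp
    also have "chi (3 * k) 3 = chi k 27"
      using chi_times_nat[of 3 k 3] chi_power[of k 3 3] three by (simp add: mult.commute)
    finally show ?thesis by (simp add: cnj_gauss)
  qed
  finally have 1: "(\<Sum>d\<in>UNIV. \<psi> (- 3 * d) * (A k d * A ?l d * A ?m d)) =
      chi k 27 * cnj (gauss (3 * k)) * (gauss k * gauss ?l * gauss ?m)" .
  have "(\<Sum>d\<in>UNIV. \<psi> (- 3 * d) * (A k d * A ?l d * A ?m d)) =
      (\<Sum>d\<in>UNIV. \<Sum>b\<in>UNIV. \<Sum>c\<in>UNIV. \<Sum>a\<in>UNIV.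
         (chi k a * chi ?l b * chi ?m c) * \<psi> ((a - (3 - b - c)) * d))"
  proof (intro sum.cong refl)
    fix d :: 'a
    have "A k d * A ?l d * A ?m d = A ?l d * A ?m d * A k d" by simp
    also have "\<dots> = (\<Sum>b\<in>UNIV. \<Sum>c\<in>UNIV. \<Sum>a\<in>UNIV.
        chi ?l b * \<psi> (d * b) * (chi ?m c * \<psi> (d * c)) * (chi k a * \<psi> (d * a)))"
      unfolding A_def
          by (subst sum_product) (simp only: sum_distrib_right, simp only: sum_distrib_left)
    finally show "\<psi> (- 3 * d) * (A k d * A ?l d * A ?m d) = (\<Sum>b\<in>UNIV. \<Sum>c\<in>UNIV. \<Sum>a\<in>UNIV.
         (chi k a * chi ?l b * chi ?m c) * \<psi> ((a - (3 - b - c)) * d))"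
      apply (simp only: sum_distrib_left)
      apply (intro sum.cong refl)
      subgoal for b c a
      proof -
        have "(a - (3 - b - c)) * d = - 3 * d + (d * b + (d * c + d * a))"
          by (simp add: algebra_simps)
        hence "\<psi> ((a - (3 - b - c)) * d) = \<psi> (- 3 * d) * (\<psi> (d * b) * (\<psi> (d * c) * \<psi> (d * a)))"
          by (simp only: \<psi>_add)
        thus ?thesis by (simp only: mult_ac)
      qed
      done
  qed
  also have "\<dots> = (\<Sum>b\<in>UNIV. \<Sum>c\<in>UNIV. \<Sum>a\<in>UNIV. \<Sum>d\<in>UNIV.
         (chi k a * chi ?l b * chi ?m c) * \<psi> ((a - (3 - b - c)) * d))"
    by (subst sum.swap, rule sum.cong [OF refl], subst sum.swap, rule sum.cong [OF refl],
        rule sum.swap)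
  also have "\<dots> = (\<Sum>b\<in>UNIV. \<Sum>c\<in>UNIV.
      (chi k (3 - b - c) * chi ?l b * chi ?m c) * of_nat CARD('a))"
    by (simp add: sum_\<psi> if_distrib[of "\<lambda>z. _ * z"] flip: sum_distrib_left cong: if_cong)
  also have "\<dots> = of_nat CARD('a) * jacobi3 h k"
  proof -
    have "chi k (3 - b - c) * chi ?l b * chi ?m c =
      chi k ((3 - b - c) * b * c) * chi (int h) (b * c ^ 2)" for b c
      by (simp only: chi_add chi_mult power2_eq_square mult_2) (simp only: mult_ac)
    thus ?thesis by (simp add: jacobi3_def sum_distrib_left mult_ac)
  qed
  finally show ?thesis using 1 by (simp add: mult_ac)
qed

text \<open>The curve \<open>a b c = 1\<close>, \<open>a + b + c = 3\<close> is a nodal cubic with node \<open>(1, 1, 1)\<close>, and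
  the cubic character is trivial on \<open>b c\<^sup>2\<close> all along it.\<close>

lemma sum_nodal_cubic:
  assumes h: "n = 3 * h"
  shows "(\<Sum>(b, c)\<in>{(b, c). (3 - b - c) * b * c = 1}. chi (int h) (b * c ^ 2)) = of_nat n - 2"
proof -
  \<comment> \<open>Parameters of the points other than the node: 0 and -1 are poles, and the roots
    of t^2 + t + 1 would give the node itself.\<close>
  define D where "D = {t :: 'a. t \<noteq> 0 \<and> t \<noteq> -1 \<and> t ^ 2 + t + 1 \<noteq> 0}"
  define f where "f t = ((1 + t) ^ 2 / t, - 1 / (t * (1 + t)))" for t :: 'a
  define N where "N = {(b, c). (3 - b - c) * b * c = (1 :: 'a)}"
  have N: "N = insert (1, 1) (f ` D)"
  proof (intro equalityI subsetI)
    fix x assume x: "x \<in> N"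
    obtain b c where bc: "x = (b, c)" by (cases x)
    show "x \<in> insert (1, 1) (f ` D)"
    proof (cases "b = 1 \<and> c = 1")
      case False
      define t where "t = (2 - b - c) / (c - 1)"
      have eq: "(3 - b - c) * b * c = 1" using x bc by (simp add: N_def)
      note t = nodal_cubic_param_inverse[OF eq False, folded t_def]
      have "c \<noteq> 1"
      proof
        assume "c = 1"
        moreover have "(b - 1) ^ 2 = 1 - (3 - b - 1) * b * 1"
          by (simp add: power2_eq_square algebra_simps)
        ultimately show False using False eq by simp
      qed
      hence "t ^ 2 + t + 1 \<noteq> 0" using nodal_cubic_param(3)[OF t(1,2)] t(4) by simp
      thus ?thesis using t bc by (auto simp: D_def f_def)
    qed (simp add: bc)
  next
    fix x assume "x \<in> insert (1, 1) (f ` D)"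
    thus "x \<in> N"
      using nodal_cubic_param(1) by (auto simp: N_def D_def f_def)
  qed
  have notin: "(1, 1) \<notin> f ` D"
    using nodal_cubic_param(3) by (fastforce simp: f_def D_def)
  have inj: "inj_on f D"
  proof (rule inj_onI)
    fix s t assume s: "s \<in> D" and t: "t \<in> D" and eq: "f s = f t"
    define b c where "b = (1 + s) ^ 2 / s" and "c = - 1 / (s * (1 + s))"
    have bc: "b = (1 + t) ^ 2 / t" "c = - 1 / (t * (1 + t))"
      using eq by (simp_all add: f_def b_def c_def)
    have "c \<noteq> 1" using nodal_cubic_param(3)[of s] s by (simp add: D_def c_def)
    moreover have "2 - b - c = s * (c - 1)"
      unfolding b_def c_def using s by (intro nodal_cubic_param(4)) (auto simp: D_def)
    moreover have "2 - b - c = t * (c - 1)"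
      unfolding bc using t by (intro nodal_cubic_param(4)) (auto simp: D_def)
    ultimately show "s = t" by simp
  qed
  \<comment> \<open>The excluded parameters are 0, -1 and the two primitive cube roots of unity,
    which leaves q - 4 = n - 3.\<close>
  have card_D: "of_nat (card D) = (of_nat n - 3 :: complex)"
  proof -
    define r where "r = \<gamma> ^ h"
    have "r \<noteq> 0" using generator_nonzero by (simp add: r_def)
    have chi1: "chi 1 (\<gamma> ^ j) = 1 \<Longrightarrow> n dvd j" for j
      using chi_generator_neq_1[of "int j"] chi_times_nat[OF generator_nonzero, of 1 j]
      by (auto simp: chi_power)
    have r1: "r \<noteq> 1"
    proof
      assume "r = 1"
      hence "n dvd h" using chi1[of h] by (simp add: r_def)
      thus False using h n_pos by (auto dest: dvd_imp_le)
    qed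
    have "r ^ 3 = 1"
      using power_n[OF generator_nonzero] h by (simp add: r_def mult.commute flip: power_mult)
    moreover have "(r - 1) * (r ^ 2 + r + 1) = r ^ 3 - 1"
      by (simp add: power2_eq_square power3_eq_cube algebra_simps)
    ultimately have "(r - 1) * (r ^ 2 + r + 1) = 0" by simp
    hence r: "r ^ 2 + r + 1 = 0" using r1 by simp
    have fac: "t ^ 2 + t + 1 = 0 \<longleftrightarrow> t = r \<or> t = r ^ 2" for t
    proof -
      have r2: "r ^ 2 = - 1 - r"
      proof -
        have "r ^ 2 = (r ^ 2 + r + 1) - 1 - r" by simp
        thus ?thesis using r by simp
      qed
      have "(t - r) * (t - r ^ 2) = (t - r) * (t - (- 1 - r))" unfolding r2 ..
      also have "\<dots> = t ^ 2 + t - r - r ^ 2"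
        by (simp add: power2_eq_square algebra_simps)
      also have "\<dots> = t ^ 2 + t + 1" unfolding r2 by simp
      finally have "t ^ 2 + t + 1 = (t - r) * (t - r ^ 2)" ..
      thus ?thesis by simp
    qed
    have D: "D = UNIV - {0, -1, r, r ^ 2}" by (auto simp: D_def fac)
    have "(0 :: 'a) \<noteq> -1" by simp
    moreover have "r \<noteq> -1" using r by auto
    moreover have "r ^ 2 \<noteq> -1" using r \<open>r \<noteq> 0\<close> by auto
    moreover have "r \<noteq> r ^ 2" using r1 \<open>r \<noteq> 0\<close> by (auto simp: power2_eq_square)
    ultimately have "card {0, -1, r, r ^ 2} = 4" using \<open>r \<noteq> 0\<close> by auto
    moreover have "card {0, -1, r, r ^ 2} \<le> CARD('a)" by (rule card_mono) auto
    ultimately have "card D + 3 = n" unfolding D by (subst card_Diff_subset) (auto simp: card_eq)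
    hence "of_nat n = (of_nat (card D) + 3 :: complex)" by (metis of_nat_add of_nat_numeral)
    thus ?thesis by simp
  qed
  have "(\<Sum>(b, c)\<in>N. chi (int h) (b * c ^ 2)) = (\<Sum>(b, c)\<in>N. 1)"
  proof (intro sum.cong refl, clarify)
    fix b c assume bc: "(b, c) \<in> N"
    show "chi (int h) (b * c ^ 2) = 1"
    proof (cases "b = 1 \<and> c = 1")
      case False
      then obtain t where t: "t \<in> D" "(b, c) = f t" using bc N by auto
      hence "b * c ^ 2 = inverse (t ^ 3)"
        using nodal_cubic_param(2)[of t] by (simp add: f_def D_def)
      moreover have "chi (int h) t ^ 3 = 1"
        using chi_times_nat[of t "int h" 3] t h by (simp add: D_def chi_trivial mult.commute)
      ultimately show ?thesis by (simp add: chi_inverse chi_power)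
    qed simp
  qed
  also have "\<dots> = of_nat (card N)" by (simp add: case_prod_unfold)
  also have "card N = Suc (card D)" using notin inj by (simp add: N card_image)
  finally show ?thesis using card_D by (simp add: N_def)
qed

text \<open>All four Gauss sums in \<open>jacobi3_gauss\<close> belong to nontrivial characters, so
  each has modulus sqrt q.\<close>

lemma norm_jacobi3:
  assumes h: "n = 3 * h" and k: "\<not> int n dvd 3 * k"
  shows "norm (jacobi3 h k) = real CARD('a)"
proof -
  have nk: "\<not> int n dvd k" "\<not> int n dvd k + int h" "\<not> int n dvd k + 2 * int h"
  proof -
    \<comment> \<open>Multiplying by 3 turns a shift by a multiple of h into a multiple of
      n.\<close>
    have "int n dvd 3 * k" if "int n dvd k + j * int h" for j
    proof -
      from that have "int n dvd 3 * (k + j * int h)" by (rule dvd_mult)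
      hence "int n dvd 3 * (k + j * int h) - int n * j" by (intro dvd_diff dvd_triv_left)
      thus ?thesis using h by (simp add: algebra_simps)
    qed
    from this[of 0] this[of 1] this[of 2] k
    show "\<not> int n dvd k" "\<not> int n dvd k + int h" "\<not> int n dvd k + 2 * int h" by auto
  qed
  let ?q = "real CARD('a)"
  have three: "(3 :: 'a) \<noteq> 0" using three_nonzero h by simp
  moreover have "(27 :: 'a) = 3 ^ 3" by simp
  ultimately have "(27 :: 'a) \<noteq> 0" by (metis power_not_zero)
  have "norm (of_nat CARD('a) * jacobi3 h k) ^ 2 =
      norm (gauss k) ^ 2 * norm (gauss (k + int h)) ^ 2 * norm (gauss (k + 2 * int h)) ^ 2 *
      norm (gauss (3 * k)) ^ 2"
    unfolding jacobi3_gauss[OF h] using \<open>(27 :: 'a) \<noteq> 0\<close>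
    by (simp add: norm_mult norm_chi power_mult_distrib)
  also have "\<dots> = ?q ^ 4" using nk k by (simp add: norm_gauss power4_eq_xxxx)
  finally have "(?q * norm (jacobi3 h k)) ^ 2 = (?q * ?q) ^ 2"
    by (simp add: norm_mult power2_eq_square power4_eq_xxxx)
  hence "?q * norm (jacobi3 h k) = ?q * ?q" by (rule power2_eq_imp_eq) simp_all
  thus ?thesis by simp
qed

text \<open>The cube of \<open>chi k\<close> is trivial, so the three exponents run through 0, h, 2
  h modulo n in some order. The sign \<open>chi (int h) (-1)\<close> is 1, being both a square root
  and a cube root of 1.\<close>

lemma gauss_triple_trivial:
  assumes h: "n = 3 * h" and k: "int n dvd 3 * k"
  shows "gauss k * gauss (k + int h) * gauss (k + 2 * int h) = - of_nat CARD('a)"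
    and "chi k 27 = 1"
proof -
  have three: "(3 :: 'a) \<noteq> 0" using three_nonzero h by simp
  show "chi k 27 = 1"
    using chi_times_nat[of 3 k 3] chi_power[of k 3 3] three k
    by (simp add: mult.commute chi_trivial)
  have hpos: "h > 0" using h n_pos by simp
  have "int h dvd k" using k h by simp
  then obtain j where j: "k = int h * j" by (rule dvdE)
  define i where "i = j mod 3"
  have ji: "j = 3 * (j div 3) + i" by (simp add: i_def)
  have "int n dvd (k + l * int h) - (i + l) * int h" for l
    unfolding j h by (subst ji) (simp add: algebra_simps)
  hence shift: "gauss (k + l * int h) = gauss ((i + l) * int h)" for l by (rule gauss_cong)
  have three_h: "gauss (3 * int h) = gauss 0" "gauss (4 * int h) = gauss (int h)"
    using h by (auto intro!: gauss_cong)
  have "chi (int h) (-1) = 1"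
  proof -
    have "chi (int h) (-1) ^ 3 = 1"
      using chi_times_nat[of "-1" "int h" 3] h by (simp add: chi_trivial mult.commute)
    thus ?thesis using chi_minus_one_square[of "int h"] by (simp add: power3_eq_cube)
  qed
  moreover have "\<not> int n dvd int h" using h hpos by (auto dest: dvd_imp_le)
  moreover have "gauss (2 * int h) = gauss (- int h)" using h by (intro gauss_cong) simp
  ultimately have prod: "gauss 0 * gauss (int h) * gauss (2 * int h) = - of_nat CARD('a)"
    using gauss_mult_minus[of "int h"] by (simp add: gauss_trivial)
  have "i = 0 \<or> i = 1 \<or> i = 2" unfolding i_def by presburger
  thus "gauss k * gauss (k + int h) * gauss (k + 2 * int h) = - of_nat CARD('a)"
    using shift[of 0] shift[of 1] shift[of 2] prod three_h by (auto simp: mult_ac)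
qed

lemma jacobi3_trivial:
  assumes h: "n = 3 * h" and k: "int n dvd 3 * k"
  shows "jacobi3 h k = 1"
proof -
  have "of_nat CARD('a) * jacobi3 h k = of_nat CARD('a) * 1"
    unfolding jacobi3_gauss[OF h]
    using gauss_triple_trivial[OF h k] gauss_trivial[OF k] by (simp add: mult.assoc)
  thus ?thesis by simp
qed

text \<open>Orthogonality over k forces a b c = 1 and leaves n times the sum over the nodal
  cubic.\<close>

lemma sum_jacobi3:
  assumes h: "n = 3 * h"
  shows "(\<Sum>k<n. jacobi3 h (int k)) = of_nat n * (of_nat n - 2)"
proof -
  have "(\<Sum>k<n. jacobi3 h (int k)) = (\<Sum>b\<in>UNIV. \<Sum>c\<in>UNIV. \<Sum>k<n.
      chi (int k) ((3 - b - c) * b * c) * chi (int h) (b * c ^ 2))"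
    unfolding jacobi3_def by (subst sum.swap, rule sum.cong [OF refl], rule sum.swap)
  also have "\<dots> = (\<Sum>b\<in>UNIV. \<Sum>c\<in>UNIV.
      if (3 - b - c) * b * c = 1 then of_nat n * chi (int h) (b * c ^ 2) else 0)"
    unfolding sum_distrib_right [symmetric] sum_chi_index by (intro sum.cong refl) auto
  also have "\<dots> = (\<Sum>(b, c)\<in>UNIV. if (3 - b - c) * b * c = 1 then of_nat n * chi (int h) (b *
      c ^ 2) else 0)"
    unfolding UNIV_Times_UNIV [symmetric] by (rule sum.cartesian_product)
  also have "\<dots> = (\<Sum>(b, c)\<in>{(b, c). (3 - b - c) * b * c = 1}. of_nat n * chi (int h) (b * c ^ 2))"
    by (rule sum.mono_neutral_cong_right) (auto split: if_splits)
  also have "\<dots> = of_nat n * (\<Sum>(b, c)\<in>{(b, c). (3 - b - c) * b * c = 1}. chi (int h) (b * c ^ 2))"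
    by (simp add: sum_distrib_left case_prod_unfold)
  finally show ?thesis by (simp only: sum_nodal_cubic[OF h])
qed

text \<open>The \<open>n - 3\<close> nontrivial terms of \<open>sum_jacobi3\<close> have modulus \<open>q\<close> and add up to
  \<open>q (n - 3)\<close>, so there is no room for cancellation.\<close>

lemma jacobi3_nontrivial:
  assumes h: "n = 3 * h" and k: "\<not> int n dvd 3 * k"
  shows "jacobi3 h k = of_nat CARD('a)"
proof -
  define K where "K = {k. k < n \<and> \<not> int n dvd 3 * int k}"
  let ?q = "real CARD('a)"
  have hpos: "h > 0" using h n_pos by simp
  \<comment> \<open>The exponents with trivial cube; each contributes 1 to the total.\<close>
  have "{..<n} - K = {0, h, 2 * h}"
  proof -
    have "k \<in> {0, h, 2 * h}" if "k < n" "int n dvd 3 * int k" for k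
    proof -
      have "int h dvd int k" using that(2) h by simp
      then obtain j where j: "k = h * j" by auto
      hence "j < 3" using that(1) h by simp
      hence "j = 0 \<or> j = 1 \<or> j = 2" by auto
      thus ?thesis using j by auto
    qed
    thus ?thesis using h hpos by (auto simp: K_def)
  qed
  moreover have "K \<subseteq> {..<n}" by (auto simp: K_def)
  ultimately have split: "{..<n} = K \<union> {0, h, 2 * h}" and disj: "K \<inter> {0, h, 2 * h} = {}"
    by blast+
  have fin: "finite K" by (simp add: K_def)
  have "card {..<n} = card K + card {0, h, 2 * h}"
    unfolding split using fin disj by (intro card_Un_disjoint) auto
  hence cardK: "card K + 3 = n" using hpos by simp
  have triv: "jacobi3 h (int k) = 1" if "k \<in> {0, h, 2 * h}" for k
    using that h by (intro jacobi3_trivial) auto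
  have "(\<Sum>k<n. jacobi3 h (int k)) = (\<Sum>k\<in>K. jacobi3 h (int k)) + (\<Sum>k\<in>{0, h, 2 *
      h}. jacobi3 h (int k))"
    unfolding split using fin disj by (intro sum.union_disjoint) auto
  also have "(\<Sum>k\<in>{0, h, 2 * h}. jacobi3 h (int k)) = (\<Sum>k\<in>{0, h, 2 * h}. 1)"
    using triv by (intro sum.cong) auto
  also have "\<dots> = 3" using hpos by simp
  finally have "(\<Sum>k\<in>K. jacobi3 h (int k)) = of_nat n * (of_nat n - 2) - 3"
    by (simp add: sum_jacobi3[OF h])
  also have "\<dots> = of_nat (card K) * of_nat CARD('a)"
  proof -
    \<comment> \<open>Indeed n (n - 2) - 3 = (n - 3) (n + 1), and n + 1 = q.\<close>
    have "of_nat n = (of_nat (card K) + 3 :: complex)" by (simp flip: cardK)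
    thus ?thesis by (simp add: card_eq algebra_simps)
  qed
  finally have "Re (\<Sum>k\<in>K. jacobi3 h (int k)) = Re (of_nat (card K) * of_nat CARD('a))" by simp
  \<comment> \<open>The summands are nonnegative, so each is 0 and every \<open>jacobi3\<close>
    value has real part equal to its modulus.\<close>
  hence "(\<Sum>k\<in>K. ?q - Re (jacobi3 h (int k))) = 0"
    by (simp add: sum_subtractf)
  moreover have norm: "norm (jacobi3 h (int k)) = ?q" if "k \<in> K" for k
    using that by (intro norm_jacobi3[OF h]) (simp add: K_def)
  hence "?q - Re (jacobi3 h (int k)) \<ge> 0" if "k \<in> K" for k
    using that complex_Re_le_cmod[of "jacobi3 h (int k)"] by simp
  ultimately have Re: "Re (jacobi3 h (int k)) = ?q" if "k \<in> K" for k
    using that fin by (subst (asm) sum_nonneg_eq_0_iff) auto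
  define r where "r = nat (k mod int n)"
  have r: "int r = k mod int n" using n_pos by (simp add: r_def)
  have "int n dvd k - int r" by (simp add: r minus_mod_eq_div_mult)
  hence eq: "jacobi3 h k = jacobi3 h (int r)" by (simp add: jacobi3_def chi_cong[of k "int r"])
  have "int n dvd 3 * (k - int r)" using \<open>int n dvd k - int r\<close> by (rule dvd_mult)
  have "\<not> int n dvd 3 * int r"
  proof
    assume "int n dvd 3 * int r"
    hence "int n dvd 3 * (k - int r) + 3 * int r"
      using \<open>int n dvd 3 * (k - int r)\<close> by (intro dvd_add)
    thus False using k by simp
  qed
  moreover have "r < n" using r pos_mod_bound[of "int n" k] n_pos by linarith
  ultimately have "r \<in> K" by (simp add: K_def)
  have "Re (jacobi3 h (int r)) ^ 2 + Im (jacobi3 h (int r)) ^ 2 = ?q ^ 2"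
    using norm[OF \<open>r \<in> K\<close>] cmod_power2[of "jacobi3 h (int r)"] by simp
  hence "Im (jacobi3 h (int r)) = 0" using Re[OF \<open>r \<in> K\<close>] by simp
  thus ?thesis using Re[OF \<open>r \<in> K\<close>] by (simp add: eq complex_eq_iff)
qed

text \<open>If \<open>3 * k\<close> is nontrivial, \<open>jacobi3_gauss\<close> is evaluated with
  \<open>jacobi3_nontrivial\<close>; multiplying by \<open>gauss (3 * k)\<close> turns its conjugate
  into q. Otherwise both sides are -q.\<close>

theorem hasse_davenport_3:
  assumes h: "n = 3 * h"
  shows "gauss k * gauss (k + int h) * gauss (k + 2 * int h) * chi k 27 =
    of_nat CARD('a) * gauss (3 * k)"
proof (cases "int n dvd 3 * k")
  case True
  thus ?thesis using gauss_triple_trivial[OF h True] by (simp add: gauss_trivial)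
next
  case False
  let ?P = "gauss k * gauss (k + int h) * gauss (k + 2 * int h) * chi k 27"
  have norm: "gauss (3 * k) * cnj (gauss (3 * k)) = of_nat CARD('a)"
    using complex_norm_square[of "gauss (3 * k)"] norm_gauss[of "3 * k"] False
    by (simp flip: of_real_power)
  have "of_nat CARD('a) * of_nat CARD('a) = ?P * cnj (gauss (3 * k))"
    using jacobi3_gauss[OF h, of k] jacobi3_nontrivial[OF h False] by (simp add: mult_ac)
  hence "gauss (3 * k) * (of_nat CARD('a) * of_nat CARD('a)) =
      ?P * (gauss (3 * k) * cnj (gauss (3 * k)))"
    by (simp add: mult_ac)
  hence "of_nat CARD('a) * (of_nat CARD('a) * gauss (3 * k)) = of_nat CARD('a) * ?P"
    unfolding norm by (simp add: mult_ac)
  thus ?thesis by simp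
qed

section \<open>Greene's series as a character sum\<close>

text \<open>A character is determined by its value at the generator, which is an n-th root of
  unity.\<close>

lemma chi_generator_powers:
  assumes "mult_char \<chi>"
  shows "\<exists>k<n. \<chi> = chi (int k)"
proof -
  have \<chi>: "\<chi> 0 = 0" "\<And>x. x \<noteq> 0 \<Longrightarrow> \<chi> x \<noteq> 0" "\<And>x y. \<chi> (x * y) = \<chi> x * \<chi> y"
    using assms by (auto simp: mult_char_def)
  have one: "\<chi> 1 = 1" using \<chi>(3)[of 1 1] \<chi>(2)[of 1] by simp
  have pow: "\<chi> (x ^ j) = \<chi> x ^ j" for x j by (induction j) (simp_all add: one \<chi>(3))
  have "\<chi> \<gamma> ^ n = 1" by (simp add: pow [symmetric] power_n generator_nonzero one)
  then obtain k where k: "k < n" "\<chi> \<gamma> = cis (2 * pi * real k / real n)"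
    using bij_betw_roots_unity[OF n_pos] by (force simp: bij_betw_def)
  have "\<chi> x = chi (int k) x" for x
  proof (cases "x = 0")
    case False
    from generator[OF this] obtain j where j: "x = \<gamma> ^ j" by blast
    show ?thesis using k by (simp add: j pow chi_power chi_generator)
  qed (simp add: \<chi>)
  thus ?thesis using k(1) by blast
qed

lemma bij_betw_char_group: "bij_betw (\<lambda>k. chi (int k)) {..<n} (carrier char_group)"
  unfolding bij_betw_def
proof
  show "inj_on (\<lambda>k. chi (int k)) {..<n}"
  proof (rule inj_onI)
    fix k l assume kl: "k \<in> {..<n}" "l \<in> {..<n}" and eq: "chi (int k) = chi (int l)"
    have "cis (2 * pi * real k / real n) = cis (2 * pi * real l / real n)"
      using fun_cong[OF eq, of \<gamma>] by (simp add: chi_generator)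
    thus "k = l" using bij_betw_roots_unity[OF n_pos] kl by (auto simp: bij_betw_def dest: inj_onD)
  qed
  show "(\<lambda>k. chi (int k)) ` {..<n} = carrier char_group"
  proof (intro equalityI subsetI)
    fix \<chi> :: "'a \<Rightarrow> complex"
    assume "\<chi> \<in> carrier char_group"
    hence "mult_char \<chi>" by (simp add: char_group_def)
    then obtain k where "k < n" "\<chi> = chi (int k)" using chi_generator_powers by blast
    thus "\<chi> \<in> (\<lambda>k. chi (int k)) ` {..<n}" by blast
  qed (auto simp: char_group_def mult_char_def chi_mult)
qed

lemma char_group_mult_chi: "chi k \<otimes>\<^bsub>char_group\<^esub> chi l = chi (k + l)"
  by (simp add: char_group_def chi_add fun_eq_iff)

lemma jacobi_binom_chi:
  "jacobi_binom (chi k) (chi l) =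
    chi l (-1) / of_nat CARD('a) * (\<Sum>x\<in>UNIV. chi k x * chi (- l) (1 - x))"
  by (simp add: jacobi_binom_def cnj_chi)

text \<open>A finite-field Euler integral. Once both binomials are expanded, the sum over k is an
  orthogonality relation forcing u v x = (1 - u) (1 - v), which determines u from v. The resulting
  factor n cancels the denominator q - 1.\<close>

theorem greene_2F1_integral:
  assumes x: "x \<noteq> 0"
  shows "of_nat CARD('a) * greene_2F1 (chi a) (chi b) (chi c) x =
    chi c (-1) * (\<Sum>v\<in>UNIV. chi b v * chi (a - c) (1 - v) * chi (- a) (1 - v * (1 - x)))"
proof -
  let ?q = "of_nat CARD('a) :: complex"
  have inner: "chi b v * chi (- c) (1 - v) * (\<Sum>u\<in>UNIV. chi a u *
      (\<Sum>k<n. chi (int k) (u * v * x) * chi (- int k) ((1 - u) * (1 - v)))) =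
      of_nat n * (chi b v * chi (a - c) (1 - v) * chi (- a) (1 - v * (1 - x)))" for v
  proof (cases "v = 0 \<or> v = 1")
    case False
    define D where "D = 1 - v * (1 - x)"
    \<comment> \<open>For \<open>D = 0\<close> no u solves the equation, in agreement with
      \<open>chi (- a) 0 = 0\<close>.\<close>
    have iff: "u * v * x = (1 - u) * (1 - v) \<and> (1 - u) * (1 - v) \<noteq> 0 \<longleftrightarrow> D \<noteq> 0 \<and> u =
        (1 - v) / D" for u
    proof -
      have "u * v * x = (1 - u) * (1 - v) \<longleftrightarrow> u * D = 1 - v"
        by (auto simp: D_def algebra_simps)
      also have "\<dots> \<longleftrightarrow> D \<noteq> 0 \<and> u = (1 - v) / D" using False by (auto simp: eq_divide_eq)
      finally have *: "u * v * x = (1 - u) * (1 - v) \<longleftrightarrow> D \<noteq> 0 \<and> u = (1 - v) / D" .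
      moreover have "(1 - u) * (1 - v) \<noteq> 0" if "D \<noteq> 0" "u = (1 - v) / D"
      proof -
        have "u \<noteq> 0" using that False by auto
        moreover have "u * v * x = (1 - u) * (1 - v)" using * that by blast
        ultimately show ?thesis using False x by (metis mult_eq_0_iff)
      qed
      ultimately show ?thesis by blast
    qed
    have "(\<Sum>u\<in>UNIV. chi a u *
        (\<Sum>k<n. chi (int k) (u * v * x) * chi (- int k) ((1 - u) * (1 - v)))) =
        (\<Sum>u\<in>UNIV. if u = (1 - v) / D then (if D \<noteq> 0 then chi a u * of_nat n else 0) else 0)"
      unfolding sum_chi_index_eq iff by (intro sum.cong) auto
    also have "\<dots> = of_nat n * (chi a (1 - v) * chi (- a) D)"
      by (simp add: chi_mult chi_inverse chi_uminus divide_inverse)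
    finally have "(\<Sum>u\<in>UNIV. chi a u *
        (\<Sum>k<n. chi (int k) (u * v * x) * chi (- int k) ((1 - u) * (1 - v)))) =
        of_nat n * (chi a (1 - v) * chi (- a) D)" .
    moreover have "chi (a - c) (1 - v) = chi a (1 - v) * chi (- c) (1 - v)"
      by (simp flip: chi_add)
    ultimately show ?thesis by (simp only: D_def mult_ac)
  qed auto
  have "(\<Sum>\<chi>\<in>carrier char_group.
        jacobi_binom (chi a \<otimes>\<^bsub>char_group\<^esub> \<chi>) \<chi> *
        jacobi_binom (chi b \<otimes>\<^bsub>char_group\<^esub> \<chi>) (chi c \<otimes>\<^bsub>char_group\<^esub> \<chi>) * \<chi> x) =
      (\<Sum>k<n. jacobi_binom (chi (a + int k)) (chi (int k)) *
        jacobi_binom (chi (b + int k)) (chi (c + int k)) * chi (int k) x)"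
    unfolding sum.reindex_bij_betw [OF bij_betw_char_group, symmetric]
    by (simp only: char_group_mult_chi)
  also have "\<dots> = (\<Sum>k<n. chi c (-1) / ?q ^ 2 * (\<Sum>v\<in>UNIV. \<Sum>u\<in>UNIV.
      chi b v * chi (- c) (1 - v) * (chi a u *
      (chi (int k) (u * v * x) * chi (- int k) ((1 - u) * (1 - v))))))"
  proof (intro sum.cong refl)
    fix k :: nat
    let ?k = "int k"
    \<comment> \<open>The signs \<open>chi k (-1)\<close> of the two binomials cancel, so that only
      \<open>chi c (-1)\<close> survives.\<close>
    have sq: "chi ?k (-1) * chi ?k (-1) = 1" by (rule chi_minus_one_square)
    have "jacobi_binom (chi (a + ?k)) (chi ?k) *
        jacobi_binom (chi (b + ?k)) (chi (c + ?k)) * chi ?k x =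
      (chi ?k (-1) * chi ?k (-1)) * chi c (-1) / ?q ^ 2 *
      ((\<Sum>v\<in>UNIV. chi (b + ?k) v * chi (- (c + ?k)) (1 - v)) *
       (\<Sum>u\<in>UNIV. chi (a + ?k) u * chi (- ?k) (1 - u)) * chi ?k x)"
      by (simp add: jacobi_binom_chi chi_add power2_eq_square mult_ac del: minus_add_distrib)
    also have "(\<Sum>v\<in>UNIV. chi (b + ?k) v * chi (- (c + ?k)) (1 - v)) *
       (\<Sum>u\<in>UNIV. chi (a + ?k) u * chi (- ?k) (1 - u)) * chi ?k x =
       (\<Sum>v\<in>UNIV. \<Sum>u\<in>UNIV. (chi (b + ?k) v * chi (- (c + ?k)) (1 - v)) *
          (chi (a + ?k) u * chi (- ?k) (1 - u)) * chi ?k x)"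
      by (subst sum_product) (simp only: sum_distrib_right)
    also have "\<dots> = (\<Sum>v\<in>UNIV. \<Sum>u\<in>UNIV. chi b v * chi (- c) (1 - v) * (chi a u *
      (chi ?k (u * v * x) * chi (- ?k) ((1 - u) * (1 - v)))))"
    proof (intro sum.cong refl)
      fix u v
      have "- (c + ?k) = - c + - ?k" by simp
      thus "chi (b + ?k) v * chi (- (c + ?k)) (1 - v) * (chi (a + ?k) u * chi (- ?k) (1 - u)) *
          chi ?k x =
        chi b v * chi (- c) (1 - v) * (chi a u *
          (chi ?k (u * v * x) * chi (- ?k) ((1 - u) * (1 - v))))"
        by (simp only: chi_add chi_mult mult_ac)
    qed
    finally show "jacobi_binom (chi (a + ?k)) (chi ?k) *
        jacobi_binom (chi (b + ?k)) (chi (c + ?k)) * chi ?k x =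
      chi c (-1) / ?q ^ 2 * (\<Sum>v\<in>UNIV. \<Sum>u\<in>UNIV. chi b v * chi (- c) (1 - v) * (chi a u *
      (chi ?k (u * v * x) * chi (- ?k) ((1 - u) * (1 - v)))))"
      unfolding sq by simp
  qed
  also have "\<dots> = chi c (-1) / ?q ^ 2 * (\<Sum>k<n. \<Sum>v\<in>UNIV. \<Sum>u\<in>UNIV.
      chi b v * chi (- c) (1 - v) * (chi a u *
      (chi (int k) (u * v * x) * chi (- int k) ((1 - u) * (1 - v)))))"
    by (rule sum_distrib_left [symmetric])
  also have "(\<Sum>k<n. \<Sum>v\<in>UNIV. \<Sum>u\<in>UNIV. chi b v * chi (- c) (1 - v) * (chi a u *
      (chi (int k) (u * v * x) * chi (- int k) ((1 - u) * (1 - v))))) =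
      (\<Sum>v\<in>UNIV. \<Sum>u\<in>UNIV. \<Sum>k<n. chi b v * chi (- c) (1 - v) * (chi a u *
      (chi (int k) (u * v * x) * chi (- int k) ((1 - u) * (1 - v)))))"
    by (subst sum.swap, rule sum.cong [OF refl], rule sum.swap)
  also have "\<dots> = (\<Sum>v\<in>UNIV. chi b v * chi (- c) (1 - v) * (\<Sum>u\<in>UNIV. chi a u *
      (\<Sum>k<n. chi (int k) (u * v * x) * chi (- int k) ((1 - u) * (1 - v)))))"
    by (simp only: sum_distrib_left)
  also have "\<dots> = of_nat n *
      (\<Sum>v\<in>UNIV. chi b v * chi (a - c) (1 - v) * chi (- a) (1 - v * (1 - x)))"
    unfolding inner by (rule sum_distrib_left [symmetric])
  finally show ?thesis
    using n_pos of_nat_neq_0[of n, where ?'a = complex]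
    by (simp add: greene_2F1_def card_eq power2_eq_square)
qed

end

section \<open>Fields with \<open>q \<equiv> 1 (mod 12)\<close>\<close>

locale finite_field_characters_12 = finite_field_characters T \<gamma> \<psi>
  for T :: "'a::finite_field \<Rightarrow> complex" and \<gamma> \<psi> +
  fixes m :: nat
  assumes card_eq_12: "CARD('a) = 12 * m + 1"
begin

lemma n_eq: "n = 12 * m"
  by (simp add: n_def card_eq_12)

abbreviation M :: int where "M \<equiv> int m"

text \<open>The point-counting sum of y^2 = u^3 + t u + t, a form with equal linear and constant
  coefficients that is reached by scaling when c4 and c6 are nonzero.\<close>

definition curve_sum :: "'a \<Rightarrow> complex" where
  "curve_sum t = (\<Sum>u\<in>UNIV. chi (6 * M) (u ^ 3 + t * (u + 1)))"

text \<open>The Euler integral of Greene's series with v replaced by 1 - v; the exponent 5 M is M -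
  8 M modulo 12 M.\<close>

definition euler_sum :: "'a \<Rightarrow> complex" where
  "euler_sum \<mu> = (\<Sum>v\<in>UNIV. chi (5 * M) v * chi M (1 - v) * chi (- M) (1 - \<mu> * v))"

lemma m_pos: "m > 0"
  using n_eq n_pos by simp

lemma not_dvd: "\<not> int n dvd j * M" if "0 < j" "j < 12"
  using that m_pos by (auto simp: n_eq dest!: zdvd_imp_le)

lemma numerals_nonzero: "(2 :: 'a) \<noteq> 0" "(3 :: 'a) \<noteq> 0" "(4 :: 'a) \<noteq> 0" "(27 :: 'a) \<noteq> 0"
  "(108 :: 'a) \<noteq> 0" "(1728 :: 'a) \<noteq> 0"
proof -
  show 2: "(2 :: 'a) \<noteq> 0" by (rule two_nonzero) (simp add: n_eq)
  show 3: "(3 :: 'a) \<noteq> 0" by (rule three_nonzero) (simp add: n_eq)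
  have "(4 :: 'a) = 2 ^ 2" "(27 :: 'a) = 3 ^ 3" by simp_all
  thus 4: "(4 :: 'a) \<noteq> 0" and 27: "(27 :: 'a) \<noteq> 0" using 2 3 by (metis power_not_zero)+
  have "(108 :: 'a) = 4 * 27" "(1728 :: 'a) = 4 ^ 3 * 27" by simp_all
  thus "(108 :: 'a) \<noteq> 0" "(1728 :: 'a) \<noteq> 0" using 4 27 by (metis mult_eq_0_iff power_not_zero)+
qed

section \<open>Explicit values of the quadratic character\<close>

lemma chi_even_minus_one: "chi (2 * j) (-1) = 1"
  using chi_minus_one_square[of j] by (simp only: mult_2 chi_add)

lemma chi_quadratic_square: "chi (6 * M) (x ^ 2) = 1" if "x \<noteq> 0"
proof -
  have "chi (6 * M) (x ^ 2) = chi (12 * M) x"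
    using chi_times_nat[OF that, of "6 * M" 2] by (simp add: chi_power)
  thus ?thesis using that by (simp add: chi_trivial n_eq)
qed

lemma sqrt_minus_one: obtains i :: 'a where "i ^ 2 = -1"
proof
  define x where "x = \<gamma> ^ (6 * m)"
  have "chi (int (6 * m)) \<gamma> = -1" by (rule chi_quadratic_generator) (simp add: n_eq)
  hence "chi 1 x = -1"
    using chi_times_nat[OF generator_nonzero, of 1 "6 * m"] by (simp add: x_def chi_power)
  hence "x \<noteq> 1" by auto
  moreover have "x ^ 2 = 1"
    using power_n[OF generator_nonzero] by (simp add: x_def n_eq mult.commute flip: power_mult)
  ultimately have "x = -1" by (simp add: power2_eq_1_iff)
  thus "(\<gamma> ^ (3 * m)) ^ 2 = -1" by (simp add: x_def mult.commute flip: power_mult)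
qed

text \<open>With i^2 = -1, the identity (1 + i)^2 = 2 i gives 2 and i the same quadratic character,
  and that of i is \<open>chi (3 * M) (-1)\<close>.\<close>

lemma chi_quadratic_2: "chi (6 * M) 2 = chi M (-1)"
proof -
  obtain i :: 'a where i: "i ^ 2 = -1" by (rule sqrt_minus_one)
  hence i0: "i \<noteq> 0" by auto
  have "(1 + i) ^ 2 = 2 * i" using i by (simp add: power2_eq_square algebra_simps)
  moreover have "1 + i \<noteq> 0"
  proof
    assume "1 + i = 0"
    hence "i = -1" by (simp add: add_eq_0_iff)
    hence "(1 :: 'a) = -1" using i by simp
    thus False using numerals_nonzero(1) by (simp add: eq_neg_iff_add_eq_0)
  qed
  ultimately have "chi (6 * M) (2 * i) = 1" using chi_quadratic_square[of "1 + i"] by simp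
  hence "chi (6 * M) 2 * chi (6 * M) i = 1" by (simp add: chi_mult)
  moreover have "chi (6 * M) i = chi M (-1)"
  proof -
    have "chi (6 * M) i = chi (3 * M) (i ^ 2)"
      using chi_times_nat[OF i0, of "3 * M" 2] by (simp add: chi_power)
    also have "\<dots> = chi M (-1) * chi (2 * M) (-1)"
      unfolding i chi_add [symmetric] by simp
    finally show ?thesis by (simp add: chi_even_minus_one)
  qed
  ultimately have "chi (6 * M) 2 * chi M (-1) = 1" by simp
  hence "chi (6 * M) 2 * (chi M (-1) * chi M (-1)) = chi M (-1)"
    by (simp add: mult.assoc [symmetric])
  thus ?thesis by (simp add: chi_minus_one_square)
qed

lemma chi_quadratic_minus_one: "chi (6 * M) (-1) = 1"
  using chi_even_minus_one[of "3 * M"] by simp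

text \<open>For a primitive cube root of unity r, the square of 3 (2 r + 1) is -27, and the
  quadratic character is 1 at -1.\<close>

lemma chi_quadratic_27: "chi (6 * M) 27 = 1"
proof -
  define r where "r = \<gamma> ^ (4 * m)"
  have "chi (int (4 * m)) \<gamma> \<noteq> 1" using not_dvd[of 4] by (intro chi_generator_neq_1) simp
  moreover have "chi 1 r = chi (int (4 * m)) \<gamma>"
    using chi_times_nat[OF generator_nonzero, of 1 "4 * m"] by (simp add: r_def chi_power)
  ultimately have "r \<noteq> 1" by auto
  moreover have "r ^ 3 = 1"
    using power_n[OF generator_nonzero] by (simp add: r_def n_eq mult.commute flip: power_mult)
  moreover have "(r - 1) * (r ^ 2 + r + 1) = r ^ 3 - 1"
    by (simp add: power2_eq_square power3_eq_cube algebra_simps)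
  ultimately have r: "r ^ 2 + r + 1 = 0" by simp
  have "(3 * (2 * r + 1)) ^ 2 = 36 * (r ^ 2 + r + 1) - 27"
    by (simp add: power2_eq_square algebra_simps)
  hence sq: "(3 * (2 * r + 1)) ^ 2 = - 27" using r by simp
  hence "3 * (2 * r + 1) \<noteq> 0" using numerals_nonzero by auto
  hence "chi (6 * M) (- 27) = 1" using chi_quadratic_square sq by metis
  thus ?thesis using chi_mult[of "6 * M" "-1" 27] by (simp add: chi_quadratic_minus_one)
qed

section \<open>Mellin transforms of the curve sum and of the Euler integral\<close>

lemma mellin_curve_sum:
  "(\<Sum>t\<in>UNIV. chi k t * curve_sum t) = jacobi k (6 * M) * jacobi (3 * k + 6 * M) (- k) +
     (if int n dvd k then of_nat n else 0) + (if int n dvd k + 6 * M then of_nat n else 0)"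
proof -
  \<comment> \<open>The sum over t for fixed u. Generically t = - u^3 s / (u + 1) turns the argument
    into u^3 (1 - s). At u = -1 the argument does not depend on t, and at u = 0 it is t; these two
    cases give the delta terms.\<close>
  define F where "F u = (\<Sum>t\<in>UNIV. chi k t * chi (6 * M) (u ^ 3 + t * (u + 1)))" for u
  have F: "F u = chi k (-1) * jacobi k (6 * M) * (chi (3 * k + 6 * M) u * chi (- k) (u + 1)) +
      (if u = -1 then (if int n dvd k then of_nat n else 0) else 0) +
      (if u = 0 then (if int n dvd k + 6 * M then of_nat n else 0) else 0)" for u
  proof -
    consider "u = -1" | "u = 0" | "u \<noteq> 0" "u + 1 \<noteq> 0" by (metis add_eq_0_iff2)
    thus ?thesis
    proof cases
      case 1
      have "(-1 :: 'a) ^ 3 = -1" by simp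
      thus ?thesis using 1 by (simp add: F_def chi_quadratic_minus_one sum_chi del: power_minus_odd)
    next
      case 2
      thus ?thesis by (simp add: F_def sum_chi flip: chi_add)
    next
      case 3
      define a where "a = - (u ^ 3) / (u + 1)"
      have a: "a \<noteq> 0" using 3 by (simp add: a_def)
      have "F u = (\<Sum>s\<in>UNIV. chi k (a * s) * chi (6 * M) (u ^ 3 + a * s * (u + 1)))"
        unfolding F_def by (rule sum_times_left [OF a, symmetric])
      also have "\<dots> = (\<Sum>s\<in>UNIV. chi k a * chi (6 * M) (u ^ 3) * (chi k s * chi (6 * M) (1 - s)))"
      proof (intro sum.cong refl)
        fix s
        have "a * (u + 1) = - (u ^ 3)" using 3 by (simp add: a_def)
        hence "u ^ 3 + s * (a * (u + 1)) = u ^ 3 * (1 - s)"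
          by (simp add: algebra_simps)
        hence "u ^ 3 + a * s * (u + 1) = u ^ 3 * (1 - s)"
          by (simp only: mult_ac)
        thus "chi k (a * s) * chi (6 * M) (u ^ 3 + a * s * (u + 1)) =
            chi k a * chi (6 * M) (u ^ 3) * (chi k s * chi (6 * M) (1 - s))"
          by (simp add: chi_mult)
      qed
      also have "\<dots> = chi k a * chi (6 * M) (u ^ 3) * jacobi k (6 * M)"
        by (simp add: jacobi_def sum_distrib_left)
      also have "chi (6 * M) (u ^ 3) = chi (6 * M) u"
        using chi_quadratic_square[OF 3(1)] by (simp add: power3_eq_cube power2_eq_square chi_mult)
      also have "chi k a = chi k (-1) * chi (3 * k) u * chi (- k) (u + 1)"
      proof -
        have "chi k a = chi k (-1) * (chi k u ^ 3 / chi k (u + 1))"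
          using chi_mult[of k "-1" "u ^ 3 / (u + 1)"] by (simp add: a_def chi_divide chi_power)
        moreover have "chi (3 * k) u = chi k u ^ 3"
          using chi_times_nat[OF 3(1), of k 3] by (simp add: mult.commute)
        ultimately show ?thesis by (simp add: chi_uminus divide_inverse)
      qed
      finally show ?thesis using 3 by (auto simp: chi_add)
    qed
  qed
  have "(\<Sum>u\<in>UNIV. chi (3 * k + 6 * M) u * chi (- k) (u + 1)) =
        (\<Sum>u\<in>UNIV. chi (3 * k + 6 * M) (-1) * (chi (3 * k + 6 * M) u * chi (- k) (1 - u)))"
  proof (rule sum.reindex_bij_witness[of _ uminus uminus])
    fix u :: 'a
    show "chi (3 * k + 6 * M) (-1) * (chi (3 * k + 6 * M) (- u) * chi (- k) (1 - - u)) =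
        chi (3 * k + 6 * M) u * chi (- k) (u + 1)"
      using chi_mult[of "3 * k + 6 * M" "-1" "- u"] by (simp add: add.commute)
  qed auto
  \<comment> \<open>The exponents differ by the even number 2 (k + 3 M), which does not affect the
    value at -1.\<close>
  also have "chi (3 * k + 6 * M) (-1) = chi k (-1)"
  proof -
    have "chi (3 * k + 6 * M) (-1) = chi (k + 2 * (k + 3 * M)) (-1)" by simp
    thus ?thesis by (simp only: chi_add[of k] chi_even_minus_one mult_1_right)
  qed
  also have "(\<Sum>u\<in>UNIV. chi k (-1) * (chi (3 * k + 6 * M) u * chi (- k) (1 - u))) =
      chi k (-1) * jacobi (3 * k + 6 * M) (- k)"
    by (simp add: jacobi_def sum_distrib_left)
  finally have main: "(\<Sum>u\<in>UNIV. chi (3 * k + 6 * M) u * chi (- k) (u + 1)) =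
      chi k (-1) * jacobi (3 * k + 6 * M) (- k)" .
  have "(\<Sum>t\<in>UNIV. chi k t * curve_sum t) = (\<Sum>u\<in>UNIV. F u)"
    unfolding F_def curve_sum_def sum_distrib_left by (rule sum.swap)
  also have "\<dots> = chi k (-1) * jacobi k (6 * M) *
      (\<Sum>u\<in>UNIV. chi (3 * k + 6 * M) u * chi (- k) (u + 1)) +
      (if int n dvd k then of_nat n else 0) + (if int n dvd k + 6 * M then of_nat n else 0)"
    unfolding F sum.distrib by (simp add: sum_distrib_left)
  also have "chi k (-1) * jacobi k (6 * M) *
      (\<Sum>u\<in>UNIV. chi (3 * k + 6 * M) u * chi (- k) (u + 1)) =
      (chi k (-1) * chi k (-1)) * (jacobi k (6 * M) * jacobi (3 * k + 6 * M) (- k))"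
    unfolding main by (simp only: mult_ac)
  finally show ?thesis by (simp add: chi_minus_one_square)
qed

text \<open>Rescaling \<mu> by v separates the variables. The rescaling needs v nonzero, but the
  term v = 0 vanishes on both sides.\<close>

lemma mellin_euler_sum:
  "(\<Sum>\<mu>\<in>UNIV. chi k \<mu> * euler_sum \<mu>) = jacobi k (- M) * jacobi (5 * M - k) M"
proof -
  have inner: "(\<Sum>\<mu>\<in>UNIV. chi k \<mu> * chi (- M) (1 - \<mu> * v)) = chi (- k) v * jacobi k (- M)"
    if "v \<noteq> 0" for v
  proof -
    have "(\<Sum>\<mu>\<in>UNIV. chi k \<mu> * chi (- M) (1 - \<mu> * v)) =
        (\<Sum>\<mu>\<in>UNIV. chi k (inverse v * \<mu>) * chi (- M) (1 - inverse v * \<mu> * v))"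
      using that by (intro sum_times_left [symmetric]) simp
    thus ?thesis using that
      by (simp add: chi_mult chi_inverse chi_uminus jacobi_def sum_distrib_left mult_ac)
  qed
  have "(\<Sum>\<mu>\<in>UNIV. chi k \<mu> * euler_sum \<mu>) = (\<Sum>v\<in>UNIV. \<Sum>\<mu>\<in>UNIV.
      chi k \<mu> * (chi (5 * M) v * chi M (1 - v) * chi (- M) (1 - \<mu> * v)))"
    unfolding euler_sum_def sum_distrib_left by (rule sum.swap)
  also have "\<dots> = (\<Sum>v\<in>UNIV. chi (5 * M) v * chi M (1 - v) *
      (\<Sum>\<mu>\<in>UNIV. chi k \<mu> * chi (- M) (1 - \<mu> * v)))"
    by (simp add: sum_distrib_left mult_ac)
  also have "\<dots> = (\<Sum>v\<in>UNIV. jacobi k (- M) * (chi (5 * M - k) v * chi M (1 - v)))"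
  proof (intro sum.cong refl)
    fix v show "chi (5 * M) v * chi M (1 - v) * (\<Sum>\<mu>\<in>UNIV. chi k \<mu> * chi (- M) (1 - \<mu> * v)) =
        jacobi k (- M) * (chi (5 * M - k) v * chi M (1 - v))"
      by (cases "v = 0") (simp_all add: inner chi_diff chi_uminus[of k] divide_inverse)
  qed
  finally show ?thesis by (simp add: jacobi_def sum_distrib_left)
qed

section \<open>Reduction of both transforms to the same product of Gauss sums\<close>

lemma gauss_mult_opposite: "gauss (j * M) * gauss ((12 - j) * M) = chi (j * M) (-1) *
    of_nat CARD('a)"
  if "0 < j" "j < 12"
proof -
  have "gauss ((12 - j) * M) = gauss (- (j * M))"
    by (intro gauss_cong) (simp add: n_eq algebra_simps)
  thus ?thesis using gauss_mult_minus[of "j * M"] not_dvd[OF that] by simp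
qed

lemma gauss_quadratic_square: "gauss (6 * M) * gauss (6 * M) = of_nat CARD('a)"
  using gauss_mult_opposite[of 6] by (simp add: chi_quadratic_minus_one)

text \<open>The gamma factor to which the Mellin transforms of both sides of the key identity
  \<open>curve_sum_eq_euler_sum\<close> reduce.\<close>

definition gamma_factor :: "int \<Rightarrow> complex" where
  "gamma_factor k =
    gauss (k + 2 * M) * gauss (k + 10 * M) * gauss (3 * M - k) * gauss (9 * M - k)"

text \<open>At the two exponents with delta terms the four Gauss sums form opposite pairs. The
  remaining sign \<open>chi (3 * M) (-1)\<close> is the quadratic character of 2.\<close>

lemma gamma_factor_special:
  assumes "int n dvd k \<or> int n dvd k + 6 * M"
  shows "gamma_factor k = of_nat CARD('a) * of_nat CARD('a) * chi (6 * M) 2"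
proof -
  have "chi (3 * M) (-1) = chi (M + 2 * M) (-1)" by simp
  hence chi3: "chi (3 * M) (-1) = chi M (-1)" by (simp only: chi_add[of M] chi_even_minus_one) simp
  have even: "chi (2 * M) (-1) = 1" "chi (4 * M) (-1) = 1"
    using chi_even_minus_one[of M] chi_even_minus_one[of "2 * M"] by simp_all
  have G39: "gauss (3 * M) * gauss (9 * M) = chi M (-1) * of_nat CARD('a)"
    using gauss_mult_opposite[of 3] chi3 by simp
  have G210: "gauss (2 * M) * gauss (10 * M) = of_nat CARD('a)"
    using gauss_mult_opposite[of 2] even by simp
  have G48: "gauss (4 * M) * gauss (8 * M) = of_nat CARD('a)"
    using gauss_mult_opposite[of 4] even by simp
  show ?thesis
  proof (cases "int n dvd k")
    case True
    have "gauss (k + j) = gauss j" "gauss (j - k) = gauss j" for j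
      using True by (auto intro!: gauss_cong)
    hence "gamma_factor k = (gauss (2 * M) * gauss (10 * M)) * (gauss (3 * M) * gauss (9 * M))"
      by (simp add: gamma_factor_def)
    thus ?thesis unfolding G39 G210 by (simp add: chi_quadratic_2)
  next
    case False
    hence k: "int n dvd k + 6 * M" using assms by simp
    have shift: "gauss (k + j) = gauss (j - 6 * M)" for j
      by (rule gauss_cong) (use k in \<open>simp add: algebra_simps\<close>)
    have "int n dvd - (k + 6 * M)" using k by (simp only: dvd_minus_iff)
    hence shift': "gauss (j - k) = gauss (j + 6 * M)" for j
      by (intro gauss_cong) (simp add: algebra_simps)
    have "gauss (2 * M - 6 * M) = gauss (8 * M)" "gauss (9 * M + 6 * M) = gauss (3 * M)"
      by (auto intro!: gauss_cong simp: n_eq)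
    hence "gamma_factor k = (gauss (4 * M) * gauss (8 * M)) * (gauss (3 * M) * gauss (9 * M))"
      unfolding gamma_factor_def shift shift' by (simp add: mult_ac)
    thus ?thesis unfolding G39 G48 by (simp add: chi_quadratic_2)
  qed
qed

text \<open>Of the Gauss sums in the two Jacobi sums, the one at 3 k + 6 M is split by triplication
  and the one at -(2 k + 6 M) by duplication. The pairs at k and at k + 6 M then collapse, giving
  the two conditional factors.\<close>

lemma jacobi_curve_gamma_factor:
  "of_nat CARD('a) ^ 3 * (jacobi k (6 * M) * jacobi (3 * k + 6 * M) (- k)) =
    chi k (-1) * (if int n dvd k then 1 else of_nat CARD('a)) * (if int n dvd k + 6 *
        M then 1 else of_nat CARD('a)) *
    gamma_factor k * chi k 27 * chi (6 * M) 2 * chi (- k) 4"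
proof -
  let ?G = gauss
  let ?w = "chi k (-1)"
  have w: "?w * ?w = 1" by (rule chi_minus_one_square)
  have w6: "chi (k + 6 * M) (-1) = ?w" by (simp add: chi_add chi_quadratic_minus_one)
  have "\<not> int n dvd 6 * M" by (rule not_dvd) simp_all
  hence "\<not> (int n dvd 3 * k + 6 * M \<and> int n dvd - k)"
    by (metis dvd_add_right_iff dvd_minus_iff dvd_mult)
  hence J2: "of_nat CARD('a) * jacobi (3 * k + 6 * M) (- k) =
      ?G (3 * k + 6 * M) * ?G (- k) * ?G (- (2 * k + 6 * M))"
    using jacobi_gauss[of "3 * k + 6 * M" "- k"] chi_even_minus_one[of "k + 3 * M"]
    by (simp add: algebra_simps)
  have J1: "of_nat CARD('a) * jacobi k (6 * M) = ?w * ?G k * ?G (6 * M) * ?G (- (k + 6 * M))"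
    using jacobi_gauss[of k "6 * M"] \<open>\<not> int n dvd 6 * M\<close> w6 by simp
  \<comment> \<open>Triplication at \<open>k + 6 * M\<close> with h = 4 M, all exponents being read
    modulo 12 M.\<close>
  have "?G (3 * (k + 6 * M)) = ?G (3 * k + 6 * M)"
    by (rule gauss_cong) (simp add: n_eq)
  moreover have "?G (k + 6 * M + 2 * (4 * M)) = ?G (k + 2 * M)"
    by (rule gauss_cong) (simp add: n_eq)
  moreover have "?G (k + 6 * M + 4 * M) = ?G (k + 10 * M)"
    by (rule arg_cong[of _ _ gauss]) simp
  ultimately have G3: "of_nat CARD('a) * ?G (3 * k + 6 * M) =
      ?G (k + 6 * M) * ?G (k + 10 * M) * ?G (k + 2 * M) * chi k 27"
    using hasse_davenport_3[of "4 * m" "k + 6 * M"] n_eq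
    by (simp add: chi_add chi_quadratic_27)
  have four: "chi (3 * M - k) 4 = chi (6 * M) 2 * chi (- k) 4"
  proof -
    have "chi (3 * M) 4 = chi (6 * M) 2"
      using chi_times_nat[of 2 "3 * M" 2] chi_power[of "3 * M" 2 2] numerals_nonzero
      by simp
    thus ?thesis using chi_add[of "3 * M" "- k"] by simp
  qed
  \<comment> \<open>Duplication at \<open>3 * M - k\<close> with h = 6 M.\<close>
  have "of_nat CARD('a) * ?G (- (2 * k + 6 * M)) = chi (3 * M - k) 4 * ?G (3 * M - k) * ?G (9 *
      M - k) * ?G (6 * M)"
  proof -
    have "?G (2 * (3 * M - k)) = ?G (- (2 * k + 6 * M))"
      by (rule gauss_cong) (simp add: n_eq)
    hence "?G (3 * M - k) * ?G (9 * M - k) * ?G (6 * M) =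
        of_nat CARD('a) * chi (- (3 * M - k)) 4 * ?G (- (2 * k + 6 * M))"
    proof -
      have "int (6 * m) = 6 * M" "3 * M - k + 6 * M = 9 * M - k" "n = 2 * (6 * m)"
        by (simp_all add: n_eq)
      thus ?thesis
        using hasse_davenport_2[of "6 * m" "3 * M - k"] \<open>?G (2 * (3 * M - k)) = _\<close>
        by (simp only: chi_quadratic_minus_one mult_1)
    qed
    hence "chi (3 * M - k) 4 * (?G (3 * M - k) * ?G (9 * M - k) * ?G (6 * M)) =
        of_nat CARD('a) * ?G (- (2 * k + 6 * M)) * (chi (3 * M - k) 4 * chi (- (3 * M - k)) 4)"
      by (simp only: mult_ac)
    also have "chi (3 * M - k) 4 * chi (- (3 * M - k)) 4 = 1"
      using numerals_nonzero by (simp only: chi_uminus) simp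
    finally show ?thesis by (simp add: mult_ac)
  qed
  hence G2: "of_nat CARD('a) * ?G (- (2 * k + 6 * M)) =
      chi (6 * M) 2 * chi (- k) 4 * ?G (3 * M - k) * ?G (9 * M - k) * ?G (6 * M)"
    by (simp only: four)
  have "of_nat CARD('a) * (of_nat CARD('a) ^ 3 * (jacobi k (6 * M) * jacobi (3 * k + 6 *
      M) (- k))) =
      of_nat CARD('a) * of_nat CARD('a) * (of_nat CARD('a) * jacobi k (6 * M)) *
          (of_nat CARD('a) * jacobi (3 * k + 6 * M) (- k))"
    by (simp add: power3_eq_cube mult_ac)
  also have "\<dots> = ?w * (?G k * ?G (- k)) * ?G (6 * M) * ?G (- (k + 6 * M)) *
      (of_nat CARD('a) * ?G (3 * k + 6 * M)) * (of_nat CARD('a) * ?G (- (2 * k + 6 * M)))"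
    unfolding J1 J2 by (simp only: mult_ac)
  also have "\<dots> = ?w * (?G k * ?G (- k)) * (?G (k + 6 * M) * ?G (- (k + 6 * M))) *
      (?G (6 * M) * ?G (6 * M)) * gamma_factor k * chi k 27 * chi (6 * M) 2 * chi (- k) 4"
    unfolding G3 G2 gamma_factor_def by (simp only: mult_ac)
  also have "\<dots> = of_nat CARD('a) * ((?w * ?w) * ?w * (if int n dvd k then 1 else of_nat CARD('a)) *
      (if int n dvd k + 6 * M then 1 else of_nat CARD('a)) *
      gamma_factor k * chi k 27 * chi (6 * M) 2 * chi (- k) 4)"
    unfolding gauss_mult_minus gauss_quadratic_square w6 by (simp only: mult_ac)
  finally show ?thesis unfolding w by simp
qed

text \<open>The two auxiliary Gauss sums at M and -M pair off, and their sign cancels the signs of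
  the two Jacobi sums.\<close>

lemma jacobi_euler_gamma_factor:
  "of_nat CARD('a) * (jacobi (3 * M - k) (- M) * jacobi (2 * M + k) M) = gamma_factor k"
proof -
  let ?G = gauss
  have nd: "\<not> int n dvd M" using not_dvd[of 1] by simp
  have J1: "of_nat CARD('a) * jacobi (3 * M - k) (- M) =
      chi (2 * M - k) (-1) * ?G (3 * M - k) * ?G (- M) * ?G (k + 10 * M)"
  proof -
    have "?G (- (3 * M - k + - M)) = ?G (k + 10 * M)"
      by (rule gauss_cong) (simp add: n_eq)
    thus ?thesis using jacobi_gauss[of "3 * M - k" "- M"] nd by simp
  qed
  have J2: "of_nat CARD('a) * jacobi (2 * M + k) M =
      chi (3 * M + k) (-1) * ?G (k + 2 * M) * ?G M * ?G (9 * M - k)"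
  proof -
    have "?G (- (2 * M + k + M)) = ?G (9 * M - k)"
      by (rule gauss_cong) (simp add: n_eq)
    thus ?thesis using jacobi_gauss[of "2 * M + k" M] nd by (simp add: algebra_simps)
  qed
  have "chi (2 * M - k) (-1) * chi (3 * M + k) (-1) = chi (M + 2 * (2 * M)) (-1)"
    unfolding chi_add [symmetric] by simp
  hence chi: "chi (2 * M - k) (-1) * chi (3 * M + k) (-1) = chi M (-1)"
    by (simp only: chi_add chi_even_minus_one mult_1_right)
  have "of_nat CARD('a) * (of_nat CARD('a) * (jacobi (3 * M - k) (- M) * jacobi (2 * M + k) M)) =
      (of_nat CARD('a) * jacobi (3 * M - k) (- M)) * (of_nat CARD('a) * jacobi (2 * M + k) M)"
    by (simp only: mult_ac)
  also have "\<dots> = (chi (2 * M - k) (-1) * chi (3 * M + k) (-1)) * (?G M * ?G (- M)) * gamma_factor k"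
    unfolding J1 J2 gamma_factor_def by (simp only: mult_ac)
  also have "\<dots> = of_nat CARD('a) * ((chi M (-1) * chi M (-1)) * gamma_factor k)"
    unfolding chi gauss_mult_minus using nd by simp
  finally show ?thesis by (simp add: chi_minus_one_square)
qed

text \<open>By Mellin inversion it suffices to compare transforms. The constant -27/4 in the
  argument absorbs the values at 27 and 4 left over by the two product formulas.\<close>

theorem curve_sum_eq_euler_sum:
  assumes "\<mu> \<noteq> 0"
  shows "chi (6 * M) 2 * curve_sum (- 27 / (4 * \<mu>)) = chi (3 * M) \<mu> * euler_sum \<mu>"
proof (rule mellin_inject[OF _ assms])
  fix k0 :: int
  \<comment> \<open>The argument -27 / (4 \<mu>) inverts \<mu>, so the exponent changes
    sign.\<close>
  define k where "k = - k0"
  let ?s = "chi (6 * M) 2"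
  have s: "?s * ?s = 1" by (simp add: chi_quadratic_2 chi_minus_one_square)
  let ?c = "chi (- k) (- 27 / 4)"
  have c: "?c = chi k (-1) * chi k 4 * chi (- k) 27"
  proof -
    have "?c = chi (- k) (-1 * (27 / 4))" by simp
    also have "\<dots> = chi k (-1) * (chi (- k) 27 / chi (- k) 4)"
      by (simp only: chi_mult chi_divide chi_uminus_minus_one)
    also have "chi (- k) 27 / chi (- k) 4 = chi k 4 * chi (- k) 27"
      by (simp add: chi_uminus divide_inverse)
    finally show ?thesis by (simp only: mult.assoc)
  qed
  have "(\<Sum>\<mu>\<in>UNIV. chi k0 \<mu> * (?s * curve_sum (- 27 / (4 * \<mu>)))) =
      (\<Sum>t\<in>UNIV. ?s * ?c * (chi k t * curve_sum t))"
  proof (rule sum.reindex_bij_witness[of _ "\<lambda>t. - 27 / (4 * t)" "\<lambda>t. - 27 / (4 * t)"])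
    fix \<mu> :: 'a
    have "chi k0 \<mu> = ?c * chi k (- 27 / (4 * \<mu>))"
    proof (cases "\<mu> = 0")
      case False
      have "- 27 / (4 * \<mu>) = (- 27 / 4) * inverse \<mu>"
        using False numerals_nonzero by (simp add: field_simps)
      hence "?c * chi k (- 27 / (4 * \<mu>)) = inverse (chi k (- 27 / 4)) * chi k (- 27 / 4) *
          chi k (inverse \<mu>)"
        by (simp only: chi_mult chi_uminus mult.assoc)
      also have "inverse (chi k (- 27 / 4)) * chi k (- 27 / 4) = 1"
        using numerals_nonzero by simp
      also have "1 * chi k (inverse \<mu>) = chi k0 \<mu>"
        by (simp add: k_def chi_inverse chi_uminus)
      finally show ?thesis ..
    qed simp
    thus "?s * ?c * (chi k (- 27 / (4 * \<mu>)) * curve_sum (- 27 / (4 * \<mu>))) =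
        chi k0 \<mu> * (?s * curve_sum (- 27 / (4 * \<mu>)))" by simp
  qed (use numerals_nonzero in \<open>auto simp: field_simps\<close>)
  also have "\<dots> = ?s * ?c * (jacobi k (6 * M) * jacobi (3 * k + 6 * M) (- k) +
     (if int n dvd k then of_nat n else 0) + (if int n dvd k + 6 * M then of_nat n else 0))"
    unfolding sum_distrib_left [symmetric] mellin_curve_sum ..
  finally have L: "(\<Sum>\<mu>\<in>UNIV. chi k0 \<mu> * (?s * curve_sum (- 27 / (4 * \<mu>)))) = \<dots>" .
  \<comment> \<open>The factor \<open>chi (3 * M)\<close> shifts the exponent to the one in
    \<open>jacobi_euler_gamma_factor\<close>.\<close>
  have "(\<Sum>\<mu>\<in>UNIV. chi k0 \<mu> * (chi (3 * M) \<mu> * euler_sum \<mu>)) =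
      (\<Sum>\<mu>\<in>UNIV. chi (3 * M - k) \<mu> * euler_sum \<mu>)"
    by (simp add: k_def chi_add mult_ac)
  also have "\<dots> = jacobi (3 * M - k) (- M) * jacobi (2 * M + k) M"
    by (simp add: mellin_euler_sum)
  finally have "of_nat CARD('a) ^ 3 * (\<Sum>\<mu>\<in>UNIV. chi k0 \<mu> * (chi (3 * M) \<mu> * euler_sum \<mu>)) =
      of_nat CARD('a) ^ 2 * gamma_factor k"
    using jacobi_euler_gamma_factor[of k] by (simp add: power2_eq_square power3_eq_cube)
  moreover have "of_nat CARD('a) ^ 3 * (\<Sum>\<mu>\<in>UNIV. chi k0 \<mu> * (?s * curve_sum (- 27 / (4 * \<mu>)))) =
      of_nat CARD('a) ^ 2 * gamma_factor k"
  proof -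
    have units: "(chi k (-1) * chi k (-1)) * (chi k 4 * chi (- k) 4) * (chi (- k) 27 *
        chi k 27) = 1"
      using numerals_nonzero by (simp add: chi_minus_one_square chi_uminus)
    have "?s * ?c * (of_nat CARD('a) ^ 3 * (jacobi k (6 * M) * jacobi (3 * k + 6 * M) (- k))) =
        ((chi k (-1) * chi k (-1)) * (chi k 4 * chi (- k) 4) * (chi (- k) 27 * chi k 27)) * (?s *
            ?s) *
        ((if int n dvd k then 1 else of_nat CARD('a)) * (if int n dvd k + 6 *
            M then 1 else of_nat CARD('a)) * gamma_factor k)"
      unfolding jacobi_curve_gamma_factor c by (simp only: mult_ac)
    hence main: "?s * ?c * (of_nat CARD('a) ^ 3 * (jacobi k (6 * M) * jacobi (3 * k + 6 *
        M) (- k))) =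
        (if int n dvd k then 1 else of_nat CARD('a)) * (if int n dvd k + 6 *
            M then 1 else of_nat CARD('a)) * gamma_factor k"
      unfolding units s by simp
    have n6: "\<not> int n dvd 6 * M" by (rule not_dvd) simp_all
    show ?thesis
    proof (cases "int n dvd k \<or> int n dvd k + 6 * M")
      case False
      thus ?thesis unfolding L using main by (simp add: power2_eq_square power3_eq_cube mult_ac)
    next
      case True
      \<comment> \<open>Exactly one of the two conditions holds, since 6 M is nontrivial. The
        transform then lacks a factor q; the delta term n makes up for it, as 1 + n = q.\<close>
      have one: "((if int n dvd k then 1 else of_nat CARD('a)) * (if int n dvd k + 6 *
          M then 1 else of_nat CARD('a))) =
            (of_nat CARD('a) :: complex)"
          "(if int n dvd k then of_nat n else 0) + (if int n dvd k + 6 * M then of_nat n else 0) =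
            (of_nat n :: complex)"
        using True n6 by (auto simp: dvd_add_right_iff)
      \<comment> \<open>At the quadratic exponent this holds because -1, 4 and 27 all have quadratic
        character 1.\<close>
      have "?c = 1"
      proof (cases "int n dvd k")
        case True
        thus ?thesis unfolding c using numerals_nonzero by (simp add: chi_trivial)
      next
        case False
        have k6: "chi k x = chi (6 * M) x" for x
        proof (rule chi_cong)
          have "int n dvd (k + 6 * M) - int n" using True False by (intro dvd_diff) auto
          thus "int n dvd k - 6 * M" by (simp add: n_eq)
        qed
        have "chi (6 * M) 4 = 1" using chi_quadratic_square[of 2] numerals_nonzero by simp
        thus ?thesis
          unfolding c by (simp add: chi_uminus k6 chi_quadratic_minus_one chi_quadratic_27)
      qed
      let ?J = "jacobi k (6 * M) * jacobi (3 * k + 6 * M) (- k)"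
      have "of_nat CARD('a) ^ 3 * (?s * ?c * (?J + of_nat n)) =
          ?s * ?c * (of_nat CARD('a) ^ 3 * ?J) + ?c * (of_nat CARD('a) ^ 3 * ?s * of_nat n)"
        by (simp only: distrib_left mult_ac)
      also have "\<dots> = of_nat CARD('a) * gamma_factor k + of_nat CARD('a) ^ 3 * ?s * of_nat n"
        unfolding trans[OF main arg_cong[OF one(1), of "\<lambda>z. z * gamma_factor k"]]
        unfolding \<open>?c = 1\<close> by simp
      also have "\<dots> = of_nat CARD('a) ^ 2 * gamma_factor k"
        unfolding gamma_factor_special[OF True]
        by (simp add: card_eq power2_eq_square power3_eq_cube algebra_simps)
      finally show ?thesis unfolding L using one(2) by (simp add: add.assoc)
    qed
  qed
  ultimately have "of_nat CARD('a) ^ 3 * (\<Sum>\<mu>\<in>UNIV. chi k0 \<mu> * (?s * curve_sum (- 27 / (4 * \<mu>)))) =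
      of_nat CARD('a) ^ 3 * (\<Sum>\<mu>\<in>UNIV. chi k0 \<mu> * (chi (3 * M) \<mu> * euler_sum \<mu>))" by simp
  thus "(\<Sum>\<mu>\<in>UNIV. chi k0 \<mu> * (?s * curve_sum (- 27 / (4 * \<mu>)))) =
      (\<Sum>\<mu>\<in>UNIV. chi k0 \<mu> * (chi (3 * M) \<mu> * euler_sum \<mu>))" by simp
qed

text \<open>Replace v by 1 - v in the Euler integral and pull x out of the last factor: 1 - v (1 -
  x) = x (1 - (x - 1) / x (1 - v)).\<close>

lemma greene_2F1_euler_sum:
  assumes x: "x \<noteq> 0"
  shows "of_nat CARD('a) * greene_2F1 (chi M) (chi M) (chi (8 * M)) x =
    chi (- M) x * euler_sum ((x - 1) / x)"
proof -
  have "chi (8 * M) (-1) = 1" using chi_even_minus_one[of "4 * M"] by simp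
  hence "of_nat CARD('a) * greene_2F1 (chi M) (chi M) (chi (8 * M)) x =
      (\<Sum>v\<in>UNIV. chi M v * chi (M - 8 * M) (1 - v) * chi (- M) (1 - v * (1 - x)))"
    using greene_2F1_integral[OF x, of M M "8 * M"] by simp
  also have "\<dots> = (\<Sum>v\<in>UNIV. chi (- M) x * (chi (5 * M) v * chi M (1 - v) *
      chi (- M) (1 - (x - 1) / x * v)))"
  proof (rule sum.reindex_bij_witness[of _ "\<lambda>v. 1 - v" "\<lambda>v. 1 - v"])
    fix v :: 'a
    have "1 - v * (1 - x) = x * (1 - (x - 1) / x * (1 - v))"
      using x by (simp add: field_simps)
    moreover have "chi (M - 8 * M) (1 - v) = chi (5 * M) (1 - v)"
      by (rule chi_cong) (simp add: n_eq)
    ultimately show "chi (- M) x * (chi (5 * M) (1 - v) * chi M (1 - (1 - v)) *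
        chi (- M) (1 - (x - 1) / x * (1 - v))) =
        chi M v * chi (M - 8 * M) (1 - v) * chi (- M) (1 - v * (1 - x))"
      by (simp add: chi_mult mult_ac)
  qed auto
  finally show ?thesis by (simp add: euler_sum_def sum_distrib_left)
qed

end

section \<open>Point counts\<close>

definition c6 :: "'a::field weierstrass \<Rightarrow> 'a" where
  "c6 E = - (b2 E ^ 3) + 36 * b2 E * b4 E - 216 * b6 E"

text \<open>The factor 1728 is divisible by 4, so \<open>b8\<close> enters only through
  \<open>4 * b8\<close>, a polynomial in the other b's.\<close>

lemma discriminant_c4_c6: "1728 * discriminant E = c4 E ^ 3 - c6 E ^ 2"
proof -
  have b8: "4 * b8 E = b2 E * b6 E - b4 E ^ 2"
    by (simp add: b2_def b4_def b6_def b8_def power2_eq_square algebra_simps)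
  have "1728 * discriminant E = - 432 * b2 E ^ 2 * (4 * b8 E)
      + 1728 * (- 8 * b4 E ^ 3 - 27 * b6 E ^ 2 + 9 * b2 E * b4 E * b6 E)"
    by (simp add: discriminant_def algebra_simps)
  thus ?thesis unfolding b8 c4_def c6_def
    by (simp add: power2_eq_square power3_eq_cube algebra_simps)
qed

text \<open>A point with z nonzero normalises uniquely to z = 1; z = 0 forces x = 0 and leaves only
  (0:1:0).\<close>

lemma card_rational_points:
  fixes E :: "'a::finite_field weierstrass"
  shows "card (rational_points E) = Suc (card {(x, y). wpoly E x y 1 = 0})"
proof -
  define A where "A = {(x, y). wpoly E x y 1 = 0}"
  define f where "f = (\<lambda>(x, y). proj_point x y (1 :: 'a))"
  have mem: "(x, y, z) \<in> proj_point x y z" for x y z :: 'a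
    by (auto simp: proj_point_def intro!: exI[of _ 1])
  have scale: "proj_point (c * x) (c * y) (c * z) = proj_point x y z" if "c \<noteq> 0" for c x y z :: 'a
  proof -
    have "(\<exists>d. t = (d * (c * x), d * (c * y), d * (c * z)) \<and> d \<noteq> 0) \<longleftrightarrow>
        (\<exists>d. t = (d * x, d * y, d * z) \<and> d \<noteq> 0)" for t
    proof
      assume "\<exists>d. t = (d * (c * x), d * (c * y), d * (c * z)) \<and> d \<noteq> 0"
      then obtain d where "t = (d * (c * x), d * (c * y), d * (c * z))" "d \<noteq> 0" by blast
      thus "\<exists>d. t = (d * x, d * y, d * z) \<and> d \<noteq> 0"
        using that by (intro exI[of _ "d * c"]) (simp add: mult.assoc)
    next
      assume "\<exists>d. t = (d * x, d * y, d * z) \<and> d \<noteq> 0"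
      then obtain d where "t = (d * x, d * y, d * z)" "d \<noteq> 0" by blast
      thus "\<exists>d. t = (d * (c * x), d * (c * y), d * (c * z)) \<and> d \<noteq> 0"
        using that by (intro exI[of _ "d / c"]) simp
    qed
    thus ?thesis by (simp add: proj_point_def)
  qed
  have "rational_points E = insert (proj_point 0 1 0) (f ` A)"
  proof (intro equalityI subsetI)
    fix P assume "P \<in> rational_points E"
    then obtain x y z where P: "P = proj_point x y z" "(x, y, z) \<noteq> (0, 0, 0)" "wpoly E x y z = 0"
      by (auto simp: rational_points_def)
    show "P \<in> insert (proj_point 0 1 0) (f ` A)"
    proof (cases "z = 0")
      case True
      hence "x = 0" using P(3) by (simp add: wpoly_def)
      hence "y \<noteq> 0" using P(2) True by simp
      thus ?thesis using scale[of y 0 1 0] P(1) True \<open>x = 0\<close> by simp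
    next
      case False
      have "z ^ 3 * wpoly E (x / z) (y / z) 1 = wpoly E x y z"
        using False by (simp add: wpoly_def field_simps power2_eq_square power3_eq_cube)
      hence "wpoly E (x / z) (y / z) 1 = 0" using P(3) False by simp
      moreover have "P = f (x / z, y / z)"
        using scale[OF False, of "x / z" "y / z" 1] P(1) False by (simp add: f_def)
      ultimately show ?thesis by (auto simp: A_def)
    qed
  next
    fix P assume "P \<in> insert (proj_point 0 1 0) (f ` A)"
    thus "P \<in> rational_points E"
    proof
      assume "P = proj_point 0 1 0"
      moreover have "wpoly E 0 1 0 = 0" by (simp add: wpoly_def)
      ultimately show ?thesis by (force simp: rational_points_def)
    next
      assume "P \<in> f ` A"
      then obtain x y where "P = proj_point x y 1" "wpoly E x y 1 = 0"
        by (auto simp: A_def f_def)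
      thus ?thesis by (force simp: rational_points_def)
    qed
  qed
  moreover have "proj_point 0 1 0 \<notin> f ` A"
  proof
    assume "proj_point 0 1 0 \<in> f ` A"
    then obtain x y where "proj_point x y 1 = proj_point 0 1 (0 :: 'a)" by (auto simp: f_def)
    hence "(x, y, 1) \<in> proj_point 0 1 (0 :: 'a)" using mem by metis
    thus False by (simp add: proj_point_def)
  qed
  moreover have "inj_on f A"
  proof (rule inj_onI)
    fix s t :: "'a \<times> 'a" assume eq: "f s = f t"
    obtain x y x' y' where st: "s = (x, y)" "t = (x', y')" by (cases s, cases t)
    have "(x, y, 1) \<in> proj_point x' y' 1" using mem[of x y 1] eq by (simp add: f_def st)
    thus "s = t" by (auto simp: proj_point_def st)
  qed
  ultimately show ?thesis by (simp add: card_image A_def)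
qed

context finite_field_characters_12
begin

section \<open>The trace of Frobenius as a character sum\<close>

lemma chi_quadratic_times_square: "chi (6 * M) (c ^ 2 * x) = chi (6 * M) x" if "c \<noteq> 0"
  using that by (simp add: chi_mult chi_quadratic_square)

text \<open>Completing the square in y makes each fibre over x the set of square roots of a cubic in
  x. The point at infinity cancels the 1 in the definition of the trace.\<close>

lemma frobenius_trace_char_sum:
  "of_int (frobenius_trace E) =
    - (\<Sum>x\<in>UNIV. chi (6 * M) (4 * x ^ 3 + b2 E * x ^ 2 + 2 * b4 E * x + b6 E))"
proof -
  let ?f = "\<lambda>x. 4 * x ^ 3 + b2 E * x ^ 2 + 2 * b4 E * x + b6 E"
  have fib: "card {y. wpoly E x y 1 = 0} = card {w. w ^ 2 = ?f x}" for x
  proof (rule bij_betw_same_card)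
    have id: "(2 * y + a1 E * x + a3 E) ^ 2 - ?f x = 4 * wpoly E x y 1" for y
      by (simp add: wpoly_def b2_def b4_def b6_def power2_eq_square power3_eq_cube algebra_simps)
    have half: "2 * ((w - a1 E * x - a3 E) / 2) + a1 E * x + a3 E = w" for w
    proof -
      define y where "y = (w - a1 E * x - a3 E) / 2"
      hence "y * 2 = w - a1 E * x - a3 E" using nonzero_eq_divide_eq numerals_nonzero by blast
      hence "2 * y + a1 E * x + a3 E = w" by (simp add: mult.commute)
      thus ?thesis by (simp only: y_def)
    qed
    show "bij_betw (\<lambda>y. 2 * y + a1 E * x + a3 E) {y. wpoly E x y 1 = 0} {w. w ^ 2 = ?f x}"
    proof (rule bij_betw_byWitness[where f' = "\<lambda>w. (w - a1 E * x - a3 E) / 2"])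
      show "(\<lambda>y. 2 * y + a1 E * x + a3 E) ` {y. wpoly E x y 1 = 0} \<subseteq> {w. w ^ 2 = ?f x}"
      proof clarify
        fix y assume "wpoly E x y 1 = 0"
        thus "(2 * y + a1 E * x + a3 E) ^ 2 = ?f x"
          using id[of y] by (simp only: mult_zero_right right_minus_eq)
      qed
      show "(\<lambda>w. (w - a1 E * x - a3 E) / 2) ` {w. w ^ 2 = ?f x} \<subseteq> {y. wpoly E x y 1 = 0}"
      proof clarify
        fix w assume w: "w ^ 2 = ?f x"
        have "4 * wpoly E x ((w - a1 E * x - a3 E) / 2) 1 = 0"
          unfolding id [symmetric] half w by simp
        thus "wpoly E x ((w - a1 E * x - a3 E) / 2) 1 = 0"
          using numerals_nonzero by simp
      qed
    qed (use half numerals_nonzero in auto)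
  qed
  have "{(x, y). wpoly E x y 1 = 0} = Sigma UNIV (\<lambda>x. {y. wpoly E x y 1 = 0})" by auto
  hence "card {(x, y). wpoly E x y 1 = 0} = (\<Sum>x\<in>UNIV. card {w. w ^ 2 = ?f x})"
    by (simp add: fib)
  hence "of_nat (card {(x, y). wpoly E x y 1 = 0}) =
      (\<Sum>x\<in>UNIV. of_nat (card {w. w ^ 2 = ?f x}) :: complex)" by simp
  also have "\<dots> = (\<Sum>x\<in>UNIV. 1 + chi (6 * M) (?f x))"
    using card_square_roots[of "6 * m"] by (simp add: n_eq)
  also have "\<dots> = of_nat CARD('a) + (\<Sum>x\<in>UNIV. chi (6 * M) (?f x))"
    by (simp add: sum.distrib)
  finally show ?thesis by (simp add: frobenius_trace_def card_rational_points)
qed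

lemma frobenius_trace_curve_sum:
  assumes c4: "c4 E \<noteq> 0" and c6: "c6 E \<noteq> 0"
  shows "of_int (frobenius_trace E) =
    - chi (6 * M) (2 * c4 E * c6 E) * curve_sum (- 27 * c4 E ^ 3 / (4 * c6 E ^ 2))"
proof -
  let ?f = "\<lambda>x. 4 * x ^ 3 + b2 E * x ^ 2 + 2 * b4 E * x + b6 E"
  \<comment> \<open>Scaling by this r makes the linear and constant coefficients of the depressed
    cubic equal: 27 c4 r = 54 c6.\<close>
  define r where "r = 2 * c6 E / c4 E"
  define t where "t = - 27 * c4 E ^ 3 / (4 * c6 E ^ 2)"
  have r0: "r \<noteq> 0" using assms numerals_nonzero by (simp add: r_def)
  have n36: "(36 :: 'a) \<noteq> 0"
  proof -
    have "(36 :: 'a) = 4 * (3 * 3)" by simp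
    thus ?thesis using numerals_nonzero by (metis mult_eq_0_iff)
  qed
  have "(\<Sum>x\<in>UNIV. chi (6 * M) (?f x)) =
      (\<Sum>u\<in>UNIV. chi (6 * M) (2 * c4 E * c6 E) * chi (6 * M) (u ^ 3 + t * (u + 1)))"
  proof (rule sum.reindex_bij_witness[of _ "\<lambda>u. (r * u - 3 * b2 E) / 36" "\<lambda>x. (36 * x + 3 * b2 E) / r"])
    fix x :: 'a
    define u where "u = (36 * x + 3 * b2 E) / r"
    have ru: "r * u = 36 * x + 3 * b2 E" using r0 by (simp add: u_def)
    \<comment> \<open>The shift by 3 b2 removes the quadratic term, and 4 * 108^2 = 36^3 makes the
      cubic monic; the factor 108^2 is a square and leaves the quadratic character
      unchanged.\<close>
    have "108 ^ 2 * ?f x = (36 * x + 3 * b2 E) ^ 3 - 27 * c4 E * (36 * x + 3 * b2 E) - 54 * c6 E"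
      by (simp add: c4_def c6_def power2_eq_square power3_eq_cube algebra_simps)
    also have "\<dots> = r ^ 3 * u ^ 3 - 27 * c4 E * r * u - 54 * c6 E"
      unfolding ru [symmetric] by (simp add: power_mult_distrib)
    also have "27 * c4 E * r = 54 * c6 E" using c4 by (simp add: r_def)
    also have "r ^ 3 * u ^ 3 - 54 * c6 E * u - 54 * c6 E = r ^ 3 * (u ^ 3 + t * (u + 1))"
    proof -
      have "r ^ 3 * t = - 54 * c6 E"
      proof -
        have "r ^ 3 = 4 * c6 E ^ 2 * (2 * c6 E) / c4 E ^ 3"
          by (simp add: r_def power2_eq_square power3_eq_cube)
        moreover have "(k * s / d) * (- 27 * d / k) = - 27 * s" if "k \<noteq> 0" "d \<noteq> 0" for k s d :: 'a
          using that by simp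
        ultimately have "r ^ 3 * t = - 27 * (2 * c6 E)"
          unfolding t_def using assms numerals_nonzero by simp
        thus ?thesis by simp
      qed
      hence "r ^ 3 * (u ^ 3 + t * (u + 1)) = r ^ 3 * u ^ 3 + (- 54 * c6 E) * (u + 1)"
        by (metis distrib_left mult.assoc)
      thus ?thesis by (simp add: algebra_simps)
    qed
    \<comment> \<open>Modulo squares r^3 is 2 c4 c6, which is the quadratic twist in front of the
      sum.\<close>
    also have "r ^ 3 = (r / c4 E) ^ 2 * (2 * c4 E * c6 E)"
      using c4 by (simp add: r_def power2_eq_square power3_eq_cube)
    finally have eq: "108 ^ 2 * ?f x = (r / c4 E) ^ 2 * (2 * c4 E * c6 E * (u ^ 3 + t * (u + 1)))"
      by (simp only: mult.assoc)
    have "chi (6 * M) (?f x) = chi (6 * M) (108 ^ 2 * ?f x)"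
      using numerals_nonzero by (intro chi_quadratic_times_square [symmetric])
    also have "\<dots> = chi (6 * M) (2 * c4 E * c6 E * (u ^ 3 + t * (u + 1)))"
      unfolding eq using r0 c4 by (intro chi_quadratic_times_square) simp
    finally show "chi (6 * M) (2 * c4 E * c6 E) *
        chi (6 * M) (((36 * x + 3 * b2 E) / r) ^ 3 + t * ((36 * x + 3 * b2 E) / r + 1)) =
        chi (6 * M) (?f x)"
      unfolding u_def by (simp only: chi_mult)
  next
    fix u :: 'a
    define w where "w = (r * u - 3 * b2 E) / 36"
    hence "w * 36 = r * u - 3 * b2 E" using nonzero_eq_divide_eq[OF n36] by blast
    hence "(36 * w + 3 * b2 E) / r = u" using r0 by (simp add: mult.commute)
    thus "(36 * ((r * u - 3 * b2 E) / 36) + 3 * b2 E) / r = u" by (simp only: w_def)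
  qed (use r0 n36 in auto)
  thus ?thesis unfolding frobenius_trace_char_sum curve_sum_def t_def [symmetric]
    by (simp only: sum_distrib_left [symmetric] mult_minus_left)
qed

text \<open>For x = j / 1728, \<open>discriminant_c4_c6\<close> gives (x - 1) / x = c6^2 / c4^3, so
  \<open>curve_sum_eq_euler_sum\<close> matches the trace with Greene's series. It remains to
  compare the roots of unity in front.\<close>

theorem frobenius_trace_greene_2F1:
  assumes j0: "j_invariant E \<noteq> 0" and j1: "j_invariant E \<noteq> 1728"
  shows "of_int (frobenius_trace E) = - of_nat CARD('a) * chi M (1728 / discriminant E) *
    greene_2F1 (chi M) (chi M) (chi (8 * M)) (j_invariant E / 1728)"
proof -
  define \<Delta> where "\<Delta> = discriminant E"
  define \<mu> where "\<mu> = c6 E ^ 2 / c4 E ^ 3"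
  \<comment> \<open>Division by 0 yields 0, so a nonzero j-invariant entails a nonzero
    discriminant.\<close>
  have c4: "c4 E \<noteq> 0" and \<Delta>: "\<Delta> \<noteq> 0" using j0 by (auto simp: j_invariant_def \<Delta>_def)
  have disc: "1728 * \<Delta> = c4 E ^ 3 - c6 E ^ 2" unfolding \<Delta>_def by (rule discriminant_c4_c6)
  have c6: "c6 E \<noteq> 0"
  proof
    assume "c6 E = 0"
    hence "c4 E ^ 3 = 1728 * \<Delta>" using disc by simp
    thus False using j1 \<Delta> by (simp add: j_invariant_def \<Delta>_def)
  qed
  define x where "x = j_invariant E / 1728"
  have x: "x = c4 E ^ 3 / (1728 * \<Delta>)" by (simp add: x_def j_invariant_def \<Delta>_def mult.commute)
  have x0: "x \<noteq> 0" using c4 \<Delta> numerals_nonzero by (simp add: x)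
  have \<mu>: "(x - 1) / x = \<mu>"
  proof -
    have "(x - 1) / x = (c4 E ^ 3 - 1728 * \<Delta>) / c4 E ^ 3"
      unfolding x using c4 \<Delta> numerals_nonzero by (simp add: divide_simps)
    thus ?thesis by (simp add: disc \<mu>_def)
  qed
  have \<mu>0: "\<mu> \<noteq> 0" using c4 c6 by (simp add: \<mu>_def)
  have t: "- 27 / (4 * \<mu>) = - 27 * c4 E ^ 3 / (4 * c6 E ^ 2)" by (simp add: \<mu>_def)
  have twelve: "(12 :: 'a) \<noteq> 0"
  proof -
    have "(12 :: 'a) = 4 * 3" by simp
    thus ?thesis using numerals_nonzero by (metis mult_eq_0_iff)
  qed
  \<comment> \<open>Every factor is a power of \<open>chi M\<close>, whose values at nonzero
    arguments are 12th roots of unity, so this is a comparison of exponents modulo 12.\<close>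
  have scalar: "chi M (1728 / \<Delta>) * chi (- M) x = chi (6 * M) (c4 E) * chi (6 * M) (c6 E) *
      chi (3 * M) \<mu>"
  proof -
    have *: "chi (3 * M) y = chi M y ^ 3" "chi (6 * M) y = chi M y ^ 6" if "y \<noteq> 0" for y
      using chi_times_nat[OF that, of M 3] chi_times_nat[OF that, of M 6]
          by (simp_all add: mult.commute)
    have p12: "chi M y ^ 12 = 1" if "y \<noteq> 0" for y
      using chi_times_nat[OF that, of M 12] that by (simp add: chi_trivial n_eq)
    have "chi (6 * M) 12 = 1"
    proof -
      \<comment> \<open>Both 27 and 12 are 3 times a square.\<close>
      have "chi (6 * M) (3 ^ 2 * 3) = chi (6 * M) 3" "chi (6 * M) (2 ^ 2 * 3) = chi (6 * M) 3"
        using numerals_nonzero by (intro chi_quadratic_times_square; simp)+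
      thus ?thesis using chi_quadratic_27 by simp
    qed
    hence d: "chi M 12 ^ 6 = 1" using *(2)[OF twelve] by simp
    have "chi M 1728 = chi M 12 ^ 3" using chi_power[of M 12 3] by simp
    hence "chi M (1728 / \<Delta>) * chi (- M) x =
        (chi M 12 ^ 3 / chi M \<Delta>) * inverse (chi M (c4 E) ^ 3 / (chi M 12 ^ 3 * chi M \<Delta>))"
      unfolding chi_uminus by (simp only: x chi_divide chi_mult chi_power)
    also have "\<dots> = chi M 12 ^ 6 / chi M (c4 E) ^ 3"
    proof -
      have "(d / D) * inverse (a / (d * D)) = d * d / a" if "D \<noteq> 0" for d D a :: complex
        using that by simp
      from this[of "chi M \<Delta>"] show ?thesis using \<Delta> by (simp flip: power_add)
    qed
    \<comment> \<open>The numerator is 1, here rewritten as a 12th power so that c6 appears.\<close>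
    also have "\<dots> = chi M (c6 E) ^ 12 / chi M (c4 E) ^ 3"
      by (simp only: d p12[OF c6])
    also have "\<dots> = chi M (c4 E) ^ 6 * chi M (c6 E) ^ 6 * (chi M (c6 E) ^ 2 / chi M (c4 E) ^ 3) ^ 3"
    proof -
      have "b ^ 12 / a ^ 3 = a ^ 6 * b ^ 6 * (b ^ 2 / a ^ 3) ^ 3" if "a \<noteq> 0" for a b :: complex
      proof -
        have "(b ^ 2 / a ^ 3) ^ 3 = b ^ 6 / (a ^ 6 * a ^ 3)"
          by (simp add: power_divide flip: power_mult power_add)
        moreover have "b ^ 12 = b ^ 6 * b ^ 6" by (simp flip: power_add)
        moreover have "u * u / v = w * u * (u / (w * v))" if "w \<noteq> 0" for u v w :: complex
          using that by simp
        ultimately show ?thesis using that by (metis power_not_zero)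
      qed
      thus ?thesis using c4 by simp
    qed
    also have "\<dots> = chi (6 * M) (c4 E) * chi (6 * M) (c6 E) * chi (3 * M) \<mu>"
      unfolding *(2)[OF c4] *(2)[OF c6] *(1)[OF \<mu>0] by (simp add: \<mu>_def chi_divide chi_power)
    finally show ?thesis .
  qed
  have "of_nat CARD('a) * chi M (1728 / \<Delta>) * greene_2F1 (chi M) (chi M) (chi (8 * M)) x =
      chi M (1728 / \<Delta>) * (chi (- M) x * euler_sum \<mu>)"
    using greene_2F1_euler_sum[OF x0] by (simp add: \<mu> mult_ac)
  also have "\<dots> = chi (6 * M) (c4 E) * chi (6 * M) (c6 E) * (chi (3 * M) \<mu> * euler_sum \<mu>)"
    using scalar by (simp add: mult.assoc [symmetric])
  also have "\<dots> = chi (6 * M) (2 * c4 E * c6 E) * curve_sum (- 27 * c4 E ^ 3 / (4 * c6 E ^ 2))"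
    unfolding curve_sum_eq_euler_sum[OF \<mu>0, symmetric] t by (simp add: chi_mult)
  finally show ?thesis
    unfolding frobenius_trace_curve_sum[OF c4 c6] by (simp add: \<Delta>_def x_def)
qed

end

theorem theorem1p1:
  fixes p e q :: nat
    and E :: "'a::finite_field weierstrass"
    and T :: "'a \<Rightarrow> complex"
  assumes "Factorial_Ring.prime p"
    and "q = p ^ e"
    and "CARD('a) = q"
    and "[q = 1] (mod 12)"
    and "elliptic_curve E"
    and "j_invariant E \<noteq> 0"
    and "j_invariant E \<noteq> 1728"
    and "T \<in> carrier char_group"
    and "generate char_group {T} = carrier char_group"
  shows "of_int (frobenius_trace E) =
    - of_nat q * (T [^]\<^bsub>char_group\<^esub> ((q - 1) div 12)) (1728 / discriminant E) *
      greene_2F1 (T [^]\<^bsub>char_group\<^esub> ((q - 1) div 12))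
                 (T [^]\<^bsub>char_group\<^esub> ((q - 1) div 12))
                 (T [^]\<^bsub>char_group\<^esub> (2 * (q - 1) div 3))
                 (j_invariant E / 1728)"
proof -
  define m where "m = q div 12"
  have "q mod 12 = 1" using assms(4) by (simp add: cong_def)
  hence q: "q = 12 * m + 1" by (metis m_def mult_div_mod_eq)
  obtain g where g: "g \<noteq> 0" "\<And>x. x \<noteq> 0 \<Longrightarrow> \<exists>j::nat. x = g ^ j"
    "T g = cis (2 * pi / real (CARD('a) - 1))"
    by (rule generating_character_generator[OF assms(8,9)]) blast
  obtain \<psi> :: "'a \<Rightarrow> complex" where \<psi>: "\<psi> 0 = 1" "\<And>x y. \<psi> (x + y) = \<psi> x * \<psi> y"
    "\<And>x. cnj (\<psi> x) = \<psi> (- x)" "\<exists>x. \<psi> x \<noteq> 1"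
    using finite_field_additive_character[OF assms(1)] assms(2,3) by metis
  have T: "T 0 = 0" "\<And>x y. T (x * y) = T x * T y"
    using assms(8) by (auto simp: char_group_def mult_char_def)
  interpret finite_field_characters_12 T g \<psi> m
    by unfold_locales (use T g \<psi> q assms(3) in auto)
  have pow: "T [^]\<^bsub>char_group\<^esub> k = chi (int k)" for k
    by (rule ext) (simp add: char_group_nat_pow[of T, OF T(1)] chi_def)
  \<comment> \<open>Both natural-number divisions are exact because q = 12 m + 1.\<close>
  have "(q - 1) div 12 = m" "2 * (q - 1) div 3 = 8 * m" using q by simp_all
  thus ?thesis
    using frobenius_trace_greene_2F1[OF assms(6,7)] assms(3) by (simp add: pow)
qed

end
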